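(* Let $F_{\{a,b\}}$ be the free group on $\{a,b\}$, let $\Gamma=\Gamma_{\{a,b\}}(\langle b\rangle)$ and $\Delta=\Gamma_{\{a,b\}}(\langle b,aba^{-1}\rangle)$, and let $\Gamma\to\Delta$ be the unique morphism of pointed $\{a,b\}$-labeled graphs. Let $X$ be a countably infinite set. Then all the morphisms in the set $$\left\{\mathrm{Trimf}\circ\mathrm{Core}\circ\mathcal{F}_\varphi(\Gamma\to\Delta)\ \middle|\ \varphi\in\mathrm{Hom}_{\mathbf{FGR}}\big((\{a,b\},\emptyset),(X,W_X)\big)\right\}$$ are injective.
   Context: **Graphs.** Graphs are in the sense of Serre: a graph $\Gamma$ has a vertex set $V(\Gamma)$, an edge set $E(\Gamma)$, an initial vertex map $\iota:E(\Gamma)\to V(\Gamma)$ and an involution $e\mapsto\overline e$ on $E(\Gamma)$ with $\overline e\ne e$. A graph morphism is a pair of maps on vertices and edges commuting with $\iota$ and the involution; it is injective if both maps are injective. A path is a finite sequence of edges $e_1,\dots,e_n$ with $\iota(\overline{e_k})=\iota(e_{k+1})$; it is closed if $\iota(\overline{e_n})=\iota(e_1)$, and reduced if $e_{k+1}\ne\overline{e_k}$ for all $k$. Graphs are assumed connected. The degree (valency) of a vertex $v$ is $|\iota^{-1}(v)|$. **Labeled and core graphs.** For a set $Y$, $F_Y$ is the free group on $Y$. A $Y$-labeled graph is a graph with a label map $l:E(\Gamma)\to Y\cup Y^{-1}$ with $l(\overline e)=l(e)^{-1}$; the label of a path is the product of its edge labels in $F_Y$. Morphisms of labeled graphs preserve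 labels; morphisms of pointed labeled graphs (those with a distinguished base point) also preserve base points. For a pointed $Y$-labeled graph, $\pi_1(\Gamma)\le F_Y$ is the set of labels of closed paths starting at the base point. A labeled graph is folded if distinct edges with the same initial vertex have distinct labels. A (pointed) core graph is a connected pointed folded labeled graph in which every edge belongs to a closed reduced path starting at the base point. For $H\le F_Y$, $\Gamma_Y(H)$ is the $Y$-labeled core graph, unique up to unique isomorphism, with $\pi_1(\Gamma_Y(H))=H$; for $H\le K$ there is a unique morphism of pointed labeled graphs $\Gamma_Y(H)\to\Gamma_Y(K)$. **Core.** $\mathrm{Core}$ is the functor from pointed $X$-labeled graphs to $X$-labeled core graphs sending $\Gamma$ to the core graph with $\pi_1(\mathrm{Core}(\Gamma))=\pi_1(\Gamma)$, i.e. $\Gamma_X(\pi_1(\Gamma))$, and a morphism $\Gamma\to\Delta$ to the unique pointed morphism $\mathrm{Core}(\Gamma)\to\mathrm{Core}(\Delta)$. **The functor $\mathcal{F}_\varphi$.** A homomorphism $\varphi:F_Y\to F_X$ is non-degenerate if $\varphi(y)\neq1$ for every $y\in Y$. For such $\varphi$, $\mathcal{F}_\varphi$ is the functor from $Y$-labeled graphs to $X$-labeled graphs replacing each edge $e$ labeled $y\in Y$ by a path (with new interior vertices) from $\iota(e)$ to $\iota(\overline e)$, of length equal to that of the reduced word $\varphi(y)$ and with label $\varphi(y)$. Vertices of the original graph are kept, and the base point is kept if there is one. A morphism $f$ is sent to the morphism mapping the path replacing $e$ to the path replacing $f(e)$. **Whitehead graphs.** For an $X$-labeled graph $\Gamma$,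 $W(\Gamma)$ is the set of unordered pairs $\{l(e),l(\overline f)\}$ where $e,f\in E(\Gamma)$, $\iota(f)=\iota(\overline e)$, $f\ne\overline e$. Let $R_X$ be the graph with one vertex and edge set $X\cup X^{-1}$, with $\overline x=x^{-1}$, labeled by the identity, and let $W_X=W(R_X)$; thus $W_X$ is the set of all pairs of distinct elements of $X\cup X^{-1}$. Write $x.y=\{x,y\}$. For a reduced word $w$, $\Gamma_w$ is the $X$-labeled graph that is a simple path with label $w$. **The category $\mathbf{FGR}$.** Objects are pairs $(Y,N)$ with $Y$ a set and $N\subseteq W_Y$. For a nontrivial reduced word $w$, $\tau(w)$ denotes its last letter. A morphism $\varphi\in\mathrm{Hom}_{\mathbf{FGR}}((Y,N),(X,M))$ is a group homomorphism $\varphi:F_Y\to F_X$ such that: (i) $\varphi(y)\ne1$ for every $y\in Y$; (ii) $W(\Gamma_{\varphi(y)})\subseteq M$ for every $y\in Y$; (iii) $\tau(\varphi(x))\ne\tau(\varphi(y))$ for every $x.y\in N$; (iv) $\tau(\varphi(x)).\tau(\varphi(y))\in M$ for every $x.y\in N$. In particular, $\mathrm{Hom}_{\mathbf{FGR}}((\{a,b\},\emptyset),(X,W_X))$ is the set of all non-degenerate homomorphisms $F_{\{a,b\}}\to F_X$. **Trimf.** $\mathrm{Trimf}$ is the functor from pointed labeled core graphs to labeled core graphs without base point that forgets the base point and then trims the "tail": as long as there is a vertex $v$ of degree one, remove $v$ together with the edge $e$ with $\iota(e)=v$ and $\overline e$. It sends a morphism to its restriction to the trimmed graphs; this is well defined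 because morphisms of folded graphs are locally injective. *)

theory Defs
  imports "HOL-Algebra.Generated_Groups" "HOL-Library.Countable_Set"
begin

section \<open>Free groups\<close>

text \<open>
  The letter \<open>(x, True)\<close> stands for \<open>x\<close> and \<open>(x, False)\<close> for \<open>x\<^sup>-\<^sup>1\<close>. The elements of the free group
  are the reduced words; the product is concatenation followed by free reduction.
\<close>

type_synonym 'x letter = "'x \<times> bool"

definition letters :: "'x set \<Rightarrow> 'x letter set" where
  "letters X = X \<times> UNIV"

definition inv_letter :: "'x letter \<Rightarrow> 'x letter" where
  "inv_letter x = (fst x, \<not> snd x)"

definition reduced :: "'x letter list \<Rightarrow> bool" where
  "reduced w \<longleftrightarrow> successively (\<lambda>x y. y \<noteq> inv_letter x) w"

fun push :: "'x letter \<Rightarrow> 'x letter list \<Rightarrow> 'x letter list" where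
  "push x [] = [x]"
| "push x (y # w) = (if y = inv_letter x then w else x # y # w)"

definition reduce :: "'x letter list \<Rightarrow> 'x letter list" where
  "reduce w = foldr push w []"

definition free_group :: "'x set \<Rightarrow> 'x letter list monoid" where
  "free_group X =
     \<lparr>carrier = {w. set w \<subseteq> letters X \<and> reduced w},
      mult = (\<lambda>u v. reduce (u @ v)),
      one = []\<rparr>"

definition gen :: "'x \<Rightarrow> 'x letter list" where
  "gen x = [(x, True)]"


section \<open>Graphs and labeled graphs\<close>

record ('v, 'e) graph =
  verts :: "'v set"
  edges :: "'e set"
  init :: "'e \<Rightarrow> 'v"
  bar :: "'e \<Rightarrow> 'e"

record ('v, 'e, 'y) lgraph = "('v, 'e) graph" +
  lab :: "'e \<Rightarrow> 'y letter"

record ('v, 'e, 'y) pgraph = "('v, 'e, 'y) lgraph" +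
  base :: 'v

definition is_graph :: "('v, 'e, 'm) graph_scheme \<Rightarrow> bool" where
  "is_graph G \<longleftrightarrow>
     (\<forall>e\<in>edges G. init G e \<in> verts G \<and> bar G e \<in> edges G \<and> bar G (bar G e) = e \<and> bar G e \<noteq> e)"

definition labeled_graph :: "'y set \<Rightarrow> ('v, 'e, 'y, 'm) lgraph_scheme \<Rightarrow> bool" where
  "labeled_graph Y G \<longleftrightarrow> is_graph G \<and>
     (\<forall>e\<in>edges G. lab G e \<in> letters Y \<and> lab G (bar G e) = inv_letter (lab G e))"

fun is_path :: "('v, 'e, 'm) graph_scheme \<Rightarrow> 'v \<Rightarrow> 'e list \<Rightarrow> 'v \<Rightarrow> bool" where
  "is_path G u [] v \<longleftrightarrow> u \<in> verts G \<and> u = v"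
| "is_path G u (e # p) v \<longleftrightarrow> e \<in> edges G \<and> init G e = u \<and> is_path G (init G (bar G e)) p v"

definition reduced_path :: "('v, 'e, 'm) graph_scheme \<Rightarrow> 'e list \<Rightarrow> bool" where
  "reduced_path G p \<longleftrightarrow> successively (\<lambda>e f. f \<noteq> bar G e) p"

definition connected_graph :: "('v, 'e, 'm) graph_scheme \<Rightarrow> bool" where
  "connected_graph G \<longleftrightarrow> (\<forall>u\<in>verts G. \<forall>v\<in>verts G. \<exists>p. is_path G u p v)"

definition degree :: "('v, 'e, 'm) graph_scheme \<Rightarrow> 'v \<Rightarrow> nat" where
  "degree G v = card {e \<in> edges G. init G e = v}"

definition folded :: "('v, 'e, 'y, 'm) lgraph_scheme \<Rightarrow> bool" where
  "folded G \<longleftrightarrow>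
     (\<forall>e\<in>edges G. \<forall>f\<in>edges G. init G e = init G f \<and> lab G e = lab G f \<longrightarrow> e = f)"

definition path_label :: "('v, 'e, 'y, 'm) lgraph_scheme \<Rightarrow> 'e list \<Rightarrow> 'y letter list" where
  "path_label G p = reduce (map (lab G) p)"

definition pi1 :: "('v, 'e, 'y) pgraph \<Rightarrow> 'y letter list set" where
  "pi1 G = {path_label G p | p. is_path G (base G) p (base G)}"

definition core_graph :: "'y set \<Rightarrow> ('v, 'e, 'y) pgraph \<Rightarrow> bool" where
  "core_graph Y G \<longleftrightarrow>
     labeled_graph Y G \<and> base G \<in> verts G \<and> connected_graph G \<and> folded G \<and>
     (\<forall>e\<in>edges G. \<exists>p. is_path G (base G) p (base G) \<and> reduced_path G p \<and> e \<in> set p)"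

text \<open>
  The core graph of a subgroup is determined only up to unique isomorphism, so it is a predicate:
  \<open>is_Gamma Y H G\<close> says that \<open>G\<close> is a representative of \<open>\<Gamma>\<^sub>Y(H)\<close>. See \<open>is_Gamma_exists\<close> below.
\<close>

definition is_Gamma :: "'y set \<Rightarrow> 'y letter list set \<Rightarrow> ('v, 'e, 'y) pgraph \<Rightarrow> bool" where
  "is_Gamma Y H G \<longleftrightarrow> core_graph Y G \<and> pi1 G = H"


section \<open>Morphisms\<close>

record ('g, 'h, 'v, 'e, 'w, 'f) arrow =
  source :: 'g
  target :: 'h
  vmap :: "'v \<Rightarrow> 'w"
  emap :: "'e \<Rightarrow> 'f"

type_synonym ('v, 'e, 'w, 'f, 'y) parrow =
  "(('v, 'e, 'y) pgraph, ('w, 'f, 'y) pgraph, 'v, 'e, 'w, 'f) arrow"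

type_synonym ('v, 'e, 'w, 'f, 'y) larrow =
  "(('v, 'e, 'y) lgraph, ('w, 'f, 'y) lgraph, 'v, 'e, 'w, 'f) arrow"

definition pointed_morphism :: "('v, 'e, 'w, 'f, 'y) parrow \<Rightarrow> bool" where
  "pointed_morphism f \<longleftrightarrow>
     (\<forall>v\<in>verts (source f). vmap f v \<in> verts (target f)) \<and>
     (\<forall>e\<in>edges (source f).
        emap f e \<in> edges (target f) \<and>
        init (target f) (emap f e) = vmap f (init (source f) e) \<and>
        bar (target f) (emap f e) = emap f (bar (source f) e) \<and>
        lab (target f) (emap f e) = lab (source f) e) \<and>
     vmap f (base (source f)) = base (target f)"

definition injective_morphism :: "('v, 'e, 'w, 'f, 'y) larrow \<Rightarrow> bool" where
  "injective_morphism f \<longleftrightarrow>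
     inj_on (vmap f) (verts (source f)) \<and> inj_on (emap f) (edges (source f))"


section \<open>The functor Core\<close>

text \<open>
  \<open>is_Core X f g\<close> says that \<open>g\<close> is a representative of \<open>Core(f)\<close>. The pointed morphism between the
  given core graphs is unique, so \<open>g\<close> is determined by the choice of the two core graphs
  (up to values outside the vertex and edge sets).
\<close>

definition is_Core ::
    "'x set \<Rightarrow> ('v, 'e, 'w, 'f, 'x) parrow \<Rightarrow> ('v1, 'e1, 'w1, 'f1, 'x) parrow \<Rightarrow> bool" where
  "is_Core X f g \<longleftrightarrow>
     is_Gamma X (pi1 (source f)) (source g) \<and>
     is_Gamma X (pi1 (target f)) (target g) \<and>
     pointed_morphism g"


section \<open>The functor \<open>\<F>\<^sub>\<phi>\<close>\<close>

text \<open>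
  Only the edges \<open>e\<close> with label in \<open>Y\<close> (sign \<open>True\<close>) are subdivided explicitly; their reverses are
  subdivided with them. The \<open>i\<close>-th edge (from 0) of the path replacing \<open>e\<close> is \<open>(e, i, True)\<close>, and
  \<open>(e, i, False)\<close> is its reverse; \<open>Inner e i\<close> is the \<open>i\<close>-th interior vertex, for \<open>0 < i < n\<close>, where
  \<open>n\<close> is the length of the reduced word \<open>\<phi>(y)\<close>.
\<close>

datatype ('v, 'e) fvertex = Old 'v | Inner 'e nat

type_synonym 'e fedge = "'e \<times> nat \<times> bool"

definition F_word ::
    "('y letter list \<Rightarrow> 'x letter list) \<Rightarrow> ('v, 'e, 'y) pgraph \<Rightarrow> 'e \<Rightarrow> 'x letter list" where
  "F_word \<phi> G e = \<phi> [lab G e]"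

definition F_pos ::
    "('y letter list \<Rightarrow> 'x letter list) \<Rightarrow> ('v, 'e, 'y) pgraph \<Rightarrow> 'e \<Rightarrow> nat \<Rightarrow> ('v, 'e) fvertex" where
  "F_pos \<phi> G e i =
     (if i = 0 then Old (init G e)
      else if i = length (F_word \<phi> G e) then Old (init G (bar G e))
      else Inner e i)"

definition F_graph ::
    "('y letter list \<Rightarrow> 'x letter list) \<Rightarrow> ('v, 'e, 'y) pgraph
       \<Rightarrow> (('v, 'e) fvertex, 'e fedge, 'x) pgraph" where
  "F_graph \<phi> G =
     \<lparr>verts = Old ` verts G \<union>
        {Inner e i | e i. e \<in> edges G \<and> snd (lab G e) \<and> 0 < i \<and> i < length (F_word \<phi> G e)},
      edges = {(e, i, s) | e i s. e \<in> edges G \<and> snd (lab G e) \<and> i < length (F_word \<phi> G e)},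
      init = (\<lambda>(e, i, s). F_pos \<phi> G e (if s then i else Suc i)),
      bar = (\<lambda>(e, i, s). (e, i, \<not> s)),
      lab = (\<lambda>(e, i, s). if s then F_word \<phi> G e ! i else inv_letter (F_word \<phi> G e ! i)),
      base = Old (base G)\<rparr>"

definition F_morphism ::
    "('y letter list \<Rightarrow> 'x letter list) \<Rightarrow> ('v, 'e, 'w, 'f, 'y) parrow
       \<Rightarrow> (('v, 'e) fvertex, 'e fedge, ('w, 'f) fvertex, 'f fedge, 'x) parrow" where
  "F_morphism \<phi> f =
     \<lparr>source = F_graph \<phi> (source f),
      target = F_graph \<phi> (target f),
      vmap = map_fvertex (vmap f) (emap f),
      emap = (\<lambda>(e, i, s). (emap f e, i, s))\<rparr>"


section \<open>The functor Trimf\<close>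

definition trim_step :: "('v, 'e, 'y) lgraph \<Rightarrow> ('v, 'e, 'y) lgraph \<Rightarrow> bool" where
  "trim_step G G' \<longleftrightarrow>
     (\<exists>v\<in>verts G. \<exists>e\<in>edges G. degree G v = 1 \<and> init G e = v \<and>
        G' = G\<lparr>verts := verts G - {v}, edges := edges G - {e, bar G e}\<rparr>)"

text \<open>
  In a core graph every vertex other than the base point has degree at least two, so there is
  never a choice of which vertex to trim, and the trimming terminates.
  \<open>lgraph.truncate\<close> forgets the base point.
\<close>

definition Trimf :: "('v, 'e, 'y) pgraph \<Rightarrow> ('v, 'e, 'y) lgraph" where
  "Trimf G = (SOME T. trim_step\<^sup>*\<^sup>* (lgraph.truncate G) T \<and> (\<nexists>T'. trim_step T T'))"

definition Trimf_morphism ::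
    "('v, 'e, 'w, 'f, 'y) parrow \<Rightarrow> ('v, 'e, 'w, 'f, 'y) larrow" where
  "Trimf_morphism f =
     \<lparr>source = Trimf (source f),
      target = Trimf (target f),
      vmap = restrict (vmap f) (verts (Trimf (source f))),
      emap = restrict (emap f) (edges (Trimf (source f)))\<rparr>"


section \<open>Whitehead graphs and the category FGR\<close>

definition whitehead :: "('v, 'e, 'x, 'm) lgraph_scheme \<Rightarrow> 'x letter set set" where
  "whitehead G =
     {{lab G e, lab G (bar G f)} | e f.
        e \<in> edges G \<and> f \<in> edges G \<and> init G f = init G (bar G e) \<and> f \<noteq> bar G e}"

definition rose :: "'x set \<Rightarrow> (unit, 'x letter, 'x) lgraph" where
  "rose X =
     \<lparr>verts = {()}, edges = letters X, init = (\<lambda>_. ()), bar = inv_letter, lab = (\<lambda>x. x)\<rparr>"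

definition W :: "'x set \<Rightarrow> 'x letter set set" where
  "W X = whitehead (rose X)"

definition word_graph :: "'x letter list \<Rightarrow> (nat, nat \<times> bool, 'x) lgraph" where
  "word_graph w =
     \<lparr>verts = {..length w},
      edges = {..<length w} \<times> UNIV,
      init = (\<lambda>(i, s). if s then i else Suc i),
      bar = (\<lambda>(i, s). (i, \<not> s)),
      lab = (\<lambda>(i, s). if s then w ! i else inv_letter (w ! i))\<rparr>"

definition FGR_Hom ::
    "'y set \<times> 'y letter set set \<Rightarrow> 'x set \<times> 'x letter set set
       \<Rightarrow> ('y letter list \<Rightarrow> 'x letter list) set" where
  "FGR_Hom = (\<lambda>(Y, N) (X, M).
     {\<phi> \<in> hom (free_group Y) (free_group X).
        (\<forall>y\<in>Y. \<phi> (gen y) \<noteq> []) \<and>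
        (\<forall>y\<in>Y. whitehead (word_graph (\<phi> (gen y))) \<subseteq> M) \<and>
        (\<forall>x y. {x, y} \<in> N \<longrightarrow> last (\<phi> [x]) \<noteq> last (\<phi> [y])) \<and>
        (\<forall>x y. {x, y} \<in> N \<longrightarrow> {last (\<phi> [x]), last (\<phi> [y])} \<in> M)})"

section \<open>The free group is a group\<close>

lemma inv_letter_simps [simp]:
  "inv_letter (inv_letter x) = x" "inv_letter x \<noteq> x" "inv_letter x \<in> letters X \<longleftrightarrow> x \<in> letters X"
  by (cases x; auto simp: inv_letter_def letters_def)+

lemma inv_letter_eq_iff: "inv_letter x = y \<longleftrightarrow> x = inv_letter y"
  by auto

lemma reduced_simps [simp]:
  "reduced []" "reduced [x]" "reduced (x # y # w) \<longleftrightarrow> y \<noteq> inv_letter x \<and> reduced (y # w)"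
  by (auto simp: reduced_def)

lemma reduced_append1: "reduced (u @ v) \<Longrightarrow> reduced u"
  and reduced_append2: "reduced (u @ v) \<Longrightarrow> reduced v"
  by (auto simp: reduced_def successively_append_iff)

lemma reduced_Cons: "reduced (x # w) \<Longrightarrow> reduced w"
  using reduced_append2[of "[x]" w] by simp

lemma reduced_push: "reduced w \<Longrightarrow> reduced (push x w)"
  by (cases w) (auto dest: reduced_Cons)

lemma set_push: "set (push x w) \<subseteq> insert x (set w)"
  by (cases w) auto

lemma push_inv_push: "reduced w \<Longrightarrow> push x (push (inv_letter x) w) = w"
proof (cases w)
  case (Cons y v)
  assume "reduced w"
  then show ?thesis using Cons by (cases v) auto
qed simp

lemma reduced_foldr_push: "reduced v \<Longrightarrow> reduced (foldr push u v)"
  by (induction u) (auto intro: reduced_push)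

lemma set_foldr_push: "set (foldr push u v) \<subseteq> set u \<union> set v"
proof (induction u)
  case (Cons x u)
  then show ?case using set_push[of x "foldr push u v"] by auto
qed simp

lemma reduced_reduce [simp]: "reduced (reduce w)"
  by (simp add: reduce_def reduced_foldr_push)

lemma set_reduce: "set (reduce w) \<subseteq> set w"
  using set_foldr_push[of w "[]"] by (simp add: reduce_def)

lemma foldr_push_push: "reduced v \<Longrightarrow> foldr push (push x u) v = push x (foldr push u v)"
proof (cases u)
  case (Cons y w)
  assume "reduced v"
  then have "reduced (foldr push w v)" by (rule reduced_foldr_push)
  then show ?thesis using Cons push_inv_push[of "foldr push w v" x] by simp
qed simp

lemma foldr_push_reduce: "reduced v \<Longrightarrow> foldr push (reduce u) v = foldr push u v"
  by (induction u) (simp_all add: reduce_def foldr_push_push)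

lemma reduce_append: "reduce (u @ v) = foldr push u (reduce v)"
  by (simp add: reduce_def)

lemma reduce_id [simp]: "reduced w \<Longrightarrow> reduce w = w"
proof (induction w)
  case (Cons x w)
  then have "reduce (x # w) = push x w"
    using reduced_Cons[of x w] by (simp add: reduce_def)
  then show ?case using Cons.prems by (cases w) auto
qed (simp add: reduce_def)

lemma reduce_reduce_left: "reduce (reduce u @ v) = reduce (u @ v)"
  by (simp add: reduce_append foldr_push_reduce)

lemma reduce_reduce_right: "reduce (u @ reduce v) = reduce (u @ v)"
  by (simp add: reduce_append)

definition inv_word :: "'x letter list \<Rightarrow> 'x letter list" where
  "inv_word w = rev (map inv_letter w)"

lemma reduced_inv_word: "reduced w \<Longrightarrow> reduced (inv_word w)"
  by (auto simp: reduced_def inv_word_def successively_map inv_letter_eq_iff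
      elim: successively_mono)

lemma set_inv_word: "set w \<subseteq> letters X \<Longrightarrow> set (inv_word w) \<subseteq> letters X"
  by (auto simp: inv_word_def)

lemma reduce_inv_word: "reduce (inv_word w @ w) = []"
proof (induction w)
  case (Cons x w)
  have "reduce (inv_word (x # w) @ x # w) =
        foldr push (inv_word w) (push (inv_letter x) (push x (reduce w)))"
    by (simp add: inv_word_def reduce_def)
  also have "\<dots> = foldr push (inv_word w) (reduce w)"
    using push_inv_push[of "reduce w" "inv_letter x"] by simp
  finally show ?case using Cons by (simp add: reduce_append)
qed (simp add: inv_word_def reduce_def)

lemma free_group_simps [simp]:
  "w \<in> carrier (free_group X) \<longleftrightarrow> set w \<subseteq> letters X \<and> reduced w"
  "u \<otimes>\<^bsub>free_group X\<^esub> v = reduce (u @ v)"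
  "\<one>\<^bsub>free_group X\<^esub> = []"
  by (simp_all add: free_group_def)

lemma group_free_group: "group (free_group X)"
proof (rule groupI)
  fix u v assume "u \<in> carrier (free_group X)" "v \<in> carrier (free_group X)"
  then show "u \<otimes>\<^bsub>free_group X\<^esub> v \<in> carrier (free_group X)"
    using set_reduce[of "u @ v"] by auto
next
  fix u assume "u \<in> carrier (free_group X)"
  then show "\<exists>v\<in>carrier (free_group X). v \<otimes>\<^bsub>free_group X\<^esub> u = \<one>\<^bsub>free_group X\<^esub>"
    using set_inv_word reduced_inv_word reduce_inv_word
    by (intro bexI[of _ "inv_word u"]) auto
qed (simp_all add: reduce_reduce_left reduce_reduce_right)

lemma inv_free_group:
  assumes "w \<in> carrier (free_group X)"
  shows "inv\<^bsub>free_group X\<^esub> w = inv_word w"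
proof -
  interpret group "free_group X" by (rule group_free_group)
  show ?thesis
    using assms set_inv_word[of w X] reduced_inv_word[of w] reduce_inv_word[of w]
    by (intro inv_equality) auto
qed


section \<open>Existence of core graphs and of the morphisms between them\<close>

text \<open>
  The core of the Schreier coset graph of \<open>H\<close>: the part that is traversed by the reduced words
  in \<open>H\<close>, read from the trivial coset.
\<close>

definition schreier_core ::
    "'x set \<Rightarrow> 'x letter list set \<Rightarrow> ('x letter list set, 'x letter list set \<times> 'x letter, 'x) pgraph"
  where
  "schreier_core X H =
     \<lparr>verts = {H #>\<^bsub>free_group X\<^esub> u | u v. u @ v \<in> H},
      edges = {(H #>\<^bsub>free_group X\<^esub> u, x) | u x v. u @ x # v \<in> H},
      init = fst,
      bar = (\<lambda>(C, x). (C #>\<^bsub>free_group X\<^esub> [x], inv_letter x)),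
      lab = snd,
      base = H\<rparr>"

lemma is_path_append:
  "is_path G u p v \<Longrightarrow> is_path G v q w \<Longrightarrow> is_path G u (p @ q) w"
  by (induction p arbitrary: u) auto

context
  fixes X :: "'x set" and H :: "'x letter list set"
  assumes H: "subgroup H (free_group X)"
begin

interpretation group "free_group X" by (rule group_free_group)

private abbreviation (input) "F \<equiv> free_group X"
private abbreviation (input) "G \<equiv> schreier_core X H"

private lemma mem_H: "w \<in> H \<Longrightarrow> set w \<subseteq> letters X \<and> reduced w"
  using subgroup.mem_carrier[OF H] by fastforce

private lemma H_sub: "H \<subseteq> carrier F"
  using subgroup.subset[OF H] .

private lemma prefix_carrier:
  assumes "u @ v \<in> H"
  shows "u \<in> carrier F" "v \<in> carrier F"
  using mem_H[OF assms] reduced_append1[of u v] reduced_append2[of u v] by auto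

private lemma coset_snoc:
  assumes "u @ x # v \<in> H"
  shows "(H #>\<^bsub>F\<^esub> u) #>\<^bsub>F\<^esub> [x] = H #>\<^bsub>F\<^esub> (u @ [x])"
proof -
  have "u \<in> carrier F" "u @ [x] \<in> carrier F" "[x] \<in> carrier F"
    using prefix_carrier(1)[of u "x # v"] prefix_carrier(1)[of "u @ [x]" v] assms by auto
  then show ?thesis
    using coset_mult_assoc[OF H_sub, of u "[x]"] by simp
qed

private lemma coset_inv:
  assumes "u @ v \<in> H"
  shows "inv_word v @ inv_word u \<in> H" "H #>\<^bsub>F\<^esub> inv_word v = H #>\<^bsub>F\<^esub> u"
proof -
  have c: "u @ v \<in> carrier F" using H_sub assms by blast
  note uv = prefix_carrier[OF assms]
  have "inv\<^bsub>F\<^esub> (u @ v) \<in> H" using subgroup.m_inv_closed[OF H assms] .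
  then show 1: "inv_word v @ inv_word u \<in> H"
    using inv_free_group[OF c] by (simp add: inv_word_def)
  have iv: "inv_word v \<in> carrier F" using prefix_carrier[OF 1] by simp
  have "u \<otimes>\<^bsub>F\<^esub> inv\<^bsub>F\<^esub> (inv_word v) = u @ v"
    using inv_free_group[OF iv] c by (simp add: inv_word_def rev_map comp_def)
  then have "u \<otimes>\<^bsub>F\<^esub> inv\<^bsub>F\<^esub> (inv_word v) \<in> H" using assms by simp
  then have "H #>\<^bsub>F\<^esub> (u \<otimes>\<^bsub>F\<^esub> inv\<^bsub>F\<^esub> (inv_word v)) = H"
    using coset_join2[OF _ H] m_closed[OF uv(1) inv_closed[OF iv]] by blast
  moreover have "u \<otimes>\<^bsub>F\<^esub> inv\<^bsub>F\<^esub> (inv_word v) \<otimes>\<^bsub>F\<^esub> inv_word v = u"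
    using m_assoc[OF uv(1) inv_closed[OF iv] iv] l_inv[OF iv] r_one[OF uv(1)] by metis
  ultimately show "H #>\<^bsub>F\<^esub> inv_word v = H #>\<^bsub>F\<^esub> u"
    using coset_mult_assoc[OF H_sub m_closed[OF uv(1) inv_closed[OF iv]] iv] by metis
qed

private lemma H_base: "H #>\<^bsub>F\<^esub> [] = H"
  using coset_mult_one[OF H_sub] by simp

private lemma edgeE:
  assumes "e \<in> edges G"
  obtains u x v where "u @ x # v \<in> H" "e = (H #>\<^bsub>F\<^esub> u, x)"
    "init G e = H #>\<^bsub>F\<^esub> u" "lab G e = x" "bar G e = (H #>\<^bsub>F\<^esub> (u @ [x]), inv_letter x)"
proof -
  from assms obtain u x v where "u @ x # v \<in> H" "e = (H #>\<^bsub>F\<^esub> u, x)"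
    by (auto simp: schreier_core_def)
  then show ?thesis
    using coset_snoc[of u x v] that[of u x v] by (simp add: schreier_core_def)
qed

private fun trace :: "'x letter list \<Rightarrow> 'x letter list \<Rightarrow> ('x letter list set \<times> 'x letter) list" where
  "trace u [] = []"
| "trace u (x # v) = (H #>\<^bsub>F\<^esub> u, x) # trace (u @ [x]) v"

private lemma trace_path:
  "u @ v @ z \<in> H \<Longrightarrow> is_path G (H #>\<^bsub>F\<^esub> u) (trace u v) (H #>\<^bsub>F\<^esub> (u @ v))"
proof (induction v arbitrary: u)
  case Nil
  then show ?case by (auto simp: schreier_core_def)
next
  case (Cons x v)
  have "is_path G (H #>\<^bsub>F\<^esub> (u @ [x])) (trace (u @ [x]) v) (H #>\<^bsub>F\<^esub> ((u @ [x]) @ v))"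
    using Cons.prems by (intro Cons.IH) simp
  moreover have "u @ x # v @ z \<in> H" using Cons.prems by simp
  ultimately show ?case
    using coset_snoc[of u x "v @ z"] by (cases x) (auto simp: schreier_core_def)
qed

private lemma trace_lab: "map (lab G) (trace u v) = v"
  by (induction v arbitrary: u) (auto simp: schreier_core_def)

private lemma trace_reduced: "reduced v \<Longrightarrow> reduced_path G (trace u v)"
proof (induction v arbitrary: u)
  case (Cons x v)
  then have "reduced_path G (trace (u @ [x]) v)" using reduced_Cons[of x v] by simp
  then show ?case
    using Cons.prems by (cases v) (auto simp: reduced_path_def schreier_core_def)
qed (simp add: reduced_path_def)

private lemma trace_mem: "(H #>\<^bsub>F\<^esub> (u @ v), x) \<in> set (trace u (v @ x # w))"
proof (induction v arbitrary: u)
  case (Cons y v)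
  show ?case using Cons.IH[of "u @ [y]"] by simp
qed simp

private lemma path_coset:
  assumes "is_path G (H #>\<^bsub>F\<^esub> g) p D" "g \<in> carrier F"
  shows "D = H #>\<^bsub>F\<^esub> reduce (g @ map (lab G) p) \<and> set (map (lab G) p) \<subseteq> letters X"
  using assms
proof (induction p arbitrary: g)
  case (Cons e p)
  from Cons.prems have "e \<in> edges G" by simp
  then obtain u x v where uxv: "u @ x # v \<in> H" "e = (H #>\<^bsub>F\<^esub> u, x)"
    by (rule edgeE)
  have x: "x \<in> letters X" using mem_H[OF uxv(1)] by simp
  have ug: "H #>\<^bsub>F\<^esub> u = H #>\<^bsub>F\<^esub> g" using Cons.prems uxv by (simp add: schreier_core_def)
  have gx: "reduce (g @ [x]) \<in> carrier F"
    using m_closed[OF Cons.prems(2), of "[x]"] x by simp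
  have "init G (bar G e) = H #>\<^bsub>F\<^esub> reduce (g @ [x])"
    using ug uxv x coset_mult_assoc[OF H_sub Cons.prems(2), of "[x]"]
    by (simp add: schreier_core_def)
  then have "is_path G (H #>\<^bsub>F\<^esub> reduce (g @ [x])) p D" using Cons.prems by simp
  from Cons.IH[OF this gx] show ?case
    using uxv x by (simp add: reduce_reduce_left schreier_core_def)
qed auto

lemma is_Gamma_schreier_core: "is_Gamma X H (schreier_core X H)"
proof -
  have one: "[] \<in> H" using subgroup.one_closed[OF H] by simp
  have base: "base G = H" by (simp add: schreier_core_def)
  have baseV: "H \<in> verts G"
    using one H_base by (fastforce simp: schreier_core_def)
  have vert_coset: "H #>\<^bsub>F\<^esub> u \<in> verts G" if "u @ v \<in> H" for u v
    using that by (auto simp: schreier_core_def)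
  have edge_coset: "(H #>\<^bsub>F\<^esub> u, x) \<in> edges G" if "u @ x # v \<in> H" for u x v
    using that by (cases x) (auto simp: schreier_core_def)
  have H_self: "H #>\<^bsub>F\<^esub> h = H" if "h \<in> H" for h
    using coset_join2[OF _ H that] H_sub that by blast
  have lg: "labeled_graph X G"
    unfolding labeled_graph_def is_graph_def
  proof (intro conjI ballI)
    fix e assume "e \<in> edges G"
    then obtain u x v where e: "u @ x # v \<in> H" "e = (H #>\<^bsub>F\<^esub> u, x)"
      "init G e = H #>\<^bsub>F\<^esub> u" "lab G e = x" "bar G e = (H #>\<^bsub>F\<^esub> (u @ [x]), inv_letter x)"
      by (rule edgeE)
    have xL: "x \<in> letters X" using mem_H[OF e(1)] by simp
    show "init G e \<in> verts G" using e vert_coset by simp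
    have ci: "H #>\<^bsub>F\<^esub> inv_word v = H #>\<^bsub>F\<^esub> (u @ [x])"
      and ci': "inv_word v @ inv_word (u @ [x]) \<in> H"
      using coset_inv[of "u @ [x]" v] e(1) by simp_all
    have m: "inv_word v @ inv_letter x # inv_word u \<in> H"
      using ci' by (simp add: inv_word_def)
    from edge_coset[OF m] show "bar G e \<in> edges G" using e ci by simp
    have "H #>\<^bsub>F\<^esub> (inv_word v @ [inv_letter x]) = H #>\<^bsub>F\<^esub> u"
      using coset_inv(2)[of u "x # v"] e(1) by (simp add: inv_word_def)
    then have "(H #>\<^bsub>F\<^esub> (u @ [x])) #>\<^bsub>F\<^esub> [inv_letter x] = H #>\<^bsub>F\<^esub> u"
      using coset_snoc[OF m] ci by simp
    then show "bar G (bar G e) = e" using e by (simp add: schreier_core_def)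
    show "bar G e \<noteq> e" using e by simp
    show "lab G e \<in> letters X" using e xL by simp
    show "lab G (bar G e) = inv_letter (lab G e)" using e by (simp add: schreier_core_def)
  qed
  have conn: "connected_graph G"
    unfolding connected_graph_def
  proof (intro ballI)
    fix C D assume "C \<in> verts G" "D \<in> verts G"
    then obtain u v u' v' where *: "u @ v \<in> H" "C = H #>\<^bsub>F\<^esub> u" "u' @ v' \<in> H" "D = H #>\<^bsub>F\<^esub> u'"
      by (auto simp: schreier_core_def)
    have "is_path G C (trace u v) H"
      using trace_path[of u v "[]"] * H_self by simp
    moreover have "is_path G H (trace [] u') D"
      using trace_path[of "[]" u' v'] * H_base by simp
    ultimately show "\<exists>p. is_path G C p D" by (blast intro: is_path_append)
  qed
  have closed: "is_path G H (trace [] h) H" if "h \<in> H" for h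
    using trace_path[of "[]" h "[]"] that H_base H_self[OF that] by simp
  have core: "\<exists>p. is_path G (base G) p (base G) \<and> reduced_path G p \<and> e \<in> set p"
    if "e \<in> edges G" for e
  proof -
    from that obtain u x v where e: "u @ x # v \<in> H" "e = (H #>\<^bsub>F\<^esub> u, x)" by (rule edgeE)
    show ?thesis
      using closed[OF e(1)] trace_reduced[of "u @ x # v" "[]"] mem_H[OF e(1)]
        trace_mem[of "[]" u x v] e(2) base
      by (intro exI[of _ "trace [] (u @ x # v)"]) simp
  qed
  have "pi1 G = H"
  proof (intro equalityI subsetI)
    fix h assume "h \<in> H"
    then show "h \<in> pi1 G"
      using closed[of h] trace_lab[of "[]" h] mem_H[of h] base
      by (auto simp: pi1_def path_label_def intro!: exI[of _ "trace [] h"])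
  next
    fix w assume "w \<in> pi1 G"
    then obtain p where p: "is_path G H p H" "w = reduce (map (lab G) p)"
      using base by (auto simp: pi1_def path_label_def)
    have pc: "H = H #>\<^bsub>F\<^esub> w" "set (map (lab G) p) \<subseteq> letters X"
      using path_coset[of "[]" p H] p H_base by auto
    then have "w \<in> carrier F" using p(2) set_reduce[of "map (lab G) p"] by auto
    then show "w \<in> H" using pc(1) coset_join1[of H w] H_sub H by metis
  qed
  moreover have "folded G"
    by (auto simp: folded_def schreier_core_def)
  ultimately show ?thesis
    using lg conn core baseV base by (simp add: is_Gamma_def core_graph_def)
qed

lemma pointed_morphism_schreier_core:
  assumes K: "subgroup K (free_group X)" and "H \<subseteq> K"
  shows "pointed_morphism
    \<lparr>source = schreier_core X H, target = schreier_core X K,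
     vmap = (\<lambda>C. K <#>\<^bsub>free_group X\<^esub> C), emap = (\<lambda>(C, x). (K <#>\<^bsub>free_group X\<^esub> C, x))\<rparr>"
proof -
  have K_sub: "K \<subseteq> carrier F" using subgroup.subset[OF K] .
  have KH: "K <#>\<^bsub>F\<^esub> H = K"
  proof (intro equalityI subsetI)
    fix w assume "w \<in> K <#>\<^bsub>F\<^esub> H"
    then obtain k h where "k \<in> K" "h \<in> H" "w = k \<otimes>\<^bsub>F\<^esub> h" unfolding set_mult_def by blast
    then show "w \<in> K" using subgroup.m_closed[OF K, of k h] \<open>H \<subseteq> K\<close> by blast
  next
    fix k assume "k \<in> K"
    then have "k = k \<otimes>\<^bsub>F\<^esub> \<one>\<^bsub>F\<^esub>" using K_sub r_one by (metis subsetD)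
    then show "k \<in> K <#>\<^bsub>F\<^esub> H"
      using \<open>k \<in> K\<close> subgroup.one_closed[OF H] unfolding set_mult_def by blast
  qed
  have KC: "K <#>\<^bsub>F\<^esub> (H #>\<^bsub>F\<^esub> u) = K #>\<^bsub>F\<^esub> u" if "u \<in> carrier F" for u
    using setmult_rcos_assoc[OF K_sub H_sub that] KH by simp
  have KCx: "K <#>\<^bsub>F\<^esub> (C #>\<^bsub>F\<^esub> [x]) = (K <#>\<^bsub>F\<^esub> C) #>\<^bsub>F\<^esub> [x]"
    if "C = H #>\<^bsub>F\<^esub> u" "u @ x # v \<in> H" for C u x v
  proof -
    have "[x] \<in> carrier F" "u \<in> carrier F" using prefix_carrier[OF that(2)] by auto
    then show ?thesis
      using setmult_rcos_assoc[OF K_sub, of C "[x]"] r_coset_subset_G[OF H_sub] that(1) by simp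
  qed
  have V: "K <#>\<^bsub>F\<^esub> C \<in> verts (schreier_core X K)" if "C \<in> verts G" for C
  proof -
    from that obtain u v where "C = H #>\<^bsub>F\<^esub> u" "u @ v \<in> H" by (auto simp: schreier_core_def)
    then have "K <#>\<^bsub>F\<^esub> C = K #>\<^bsub>F\<^esub> u" "u @ v \<in> K"
      using \<open>H \<subseteq> K\<close> KC[of u] prefix_carrier(1)[of u v] by blast+
    then show ?thesis by (auto simp: schreier_core_def)
  qed
  have E: "(K <#>\<^bsub>F\<^esub> C, x) \<in> edges (schreier_core X K)"
    "K <#>\<^bsub>F\<^esub> (C #>\<^bsub>F\<^esub> [x]) = (K <#>\<^bsub>F\<^esub> C) #>\<^bsub>F\<^esub> [x]" if "(C, x) \<in> edges G" for C x
  proof -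
    from that obtain u v where u: "C = H #>\<^bsub>F\<^esub> u" "u @ x # v \<in> H"
      by (auto simp: schreier_core_def)
    then have "K <#>\<^bsub>F\<^esub> C = K #>\<^bsub>F\<^esub> u" "u @ x # v \<in> K"
      using \<open>H \<subseteq> K\<close> KC[of u] prefix_carrier(1)[of u "x # v"] by blast+
    then show "(K <#>\<^bsub>F\<^esub> C, x) \<in> edges (schreier_core X K)"
      by (cases x) (auto simp: schreier_core_def)
    show "K <#>\<^bsub>F\<^esub> (C #>\<^bsub>F\<^esub> [x]) = (K <#>\<^bsub>F\<^esub> C) #>\<^bsub>F\<^esub> [x]" by (rule KCx[OF u])
  qed
  have B: "K <#>\<^bsub>F\<^esub> base G = base (schreier_core X K)"
    using KH by (simp add: schreier_core_def)
  have S: "init (schreier_core X L) = fst" "lab (schreier_core X L) = snd"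
    "bar (schreier_core X L) = (\<lambda>(C, x). (C #>\<^bsub>F\<^esub> [x], inv_letter x))" for L
    by (simp_all add: schreier_core_def)
  show ?thesis
    unfolding pointed_morphism_def arrow.simps S
    using V E B by (simp add: split_paired_all split_paired_Ball_Sigma case_prod_beta)
qed

end

lemma is_Gamma_exists:
  assumes "subgroup H (free_group X)"
  shows "\<exists>G :: ('x letter list set, 'x letter list set \<times> 'x letter, 'x) pgraph. is_Gamma X H G"
  using is_Gamma_schreier_core[OF assms] by blast

end

theory Submission
  imports Defs
begin

text \<open>
  Write \<open>u = \<phi>(a)\<close> and \<open>v = \<phi>(b) = p c p\<^sup>-\<^sup>1\<close> with \<open>c\<close> cyclically reduced. The source is the lollipop
  \<open>\<Gamma>\<^sub>X(\<langle>v\<rangle>)\<close> with stem \<open>p\<close> and cycle \<open>c\<close>, which \<open>Trimf\<close> cuts down to the cycle, and the target is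
  \<open>\<Gamma>\<^sub>X(\<langle>v, uvu\<^sup>-\<^sup>1\<rangle>)\<close>. Two vertices of the cycle become equal in the target iff
  \<open>c\<^sub>i c\<^sub>j\<^sup>-\<^sup>1 \<in> \<langle>c, w c w\<^sup>-\<^sup>1\<rangle>\<close> for prefixes \<open>c\<^sub>i\<close>, \<open>c\<^sub>j\<close> of \<open>c\<close> and \<open>w = p\<^sup>-\<^sup>1 u p\<close>. This is refuted by
  folding: the graph consisting of a cycle \<open>c\<close>, a path \<open>w\<close> and a second cycle \<open>d\<close> of the same length
  folds to a barbell, a wedge of two cycles, a theta graph or a single cycle, and in each case the
  first cycle stays embedded. The equality of lengths is what prevents one cycle from being wrapped
  around the other.
\<close>

section \<open>Reading words in folded graphs\<close>

text \<open>The word is the unreduced sequence of labels, so it splits along concatenation exactly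
  as paths do. In a folded graph the start and the word determine the end, and
  \<open>reads_reduce\<close> makes reading stable under free reduction.\<close>

definition reads :: "('v, 'e, 'x, 'm) lgraph_scheme \<Rightarrow> 'v \<Rightarrow> 'x letter list \<Rightarrow> 'v \<Rightarrow> bool" where
  "reads G u w v \<longleftrightarrow> (\<exists>p. is_path G u p v \<and> map (lab G) p = w)"

section \<open>Inverse words and free cancellation\<close>

lemma neq_inv_letter [simp]: "x \<noteq> inv_letter x"
  by (metis inv_letter_simps(2))

lemma inv_word_simps [simp]:
  "inv_word [] = []" "inv_word (x # w) = inv_word w @ [inv_letter x]"
  "inv_word (u @ v) = inv_word v @ inv_word u" "inv_word (inv_word w) = w"
  "inv_word w = [] \<longleftrightarrow> w = []" "length (inv_word w) = length w"
  by (auto simp: inv_word_def rev_map comp_def)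

lemma hd_inv_word: "w \<noteq> [] \<Longrightarrow> hd (inv_word w) = inv_letter (last w)"
  by (simp add: inv_word_def hd_rev last_map)

lemma last_inv_word: "w \<noteq> [] \<Longrightarrow> last (inv_word w) = inv_letter (hd w)"
  by (simp add: inv_word_def last_rev hd_map)

lemma reduced_append_iff:
  "reduced (u @ v) \<longleftrightarrow> reduced u \<and> reduced v \<and> (u = [] \<or> v = [] \<or> hd v \<noteq> inv_letter (last u))"
  by (auto simp: reduced_def successively_append_iff)

lemma reduced_inv_word_iff [simp]: "reduced (inv_word w) \<longleftrightarrow> reduced w"
  using reduced_inv_word[of w] reduced_inv_word[of "inv_word w"] by auto

lemma reduce_word_inv [simp]: "reduce (w @ inv_word w) = []"
  using reduce_inv_word[of "inv_word w"] by simp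

lemma reduce_cancel_mid:
  "reduce (u @ inv_word w @ w @ v) = reduce (u @ v)" "reduce (u @ w @ inv_word w @ v) = reduce (u @ v)"
proof -
  have "reduce (u @ (inv_word w @ w) @ v) = reduce (u @ v)" for w
    by (metis append_Nil reduce_inv_word reduce_reduce_left reduce_reduce_right)
  from this[of w] this[of "inv_word w"] show
    "reduce (u @ inv_word w @ w @ v) = reduce (u @ v)" "reduce (u @ w @ inv_word w @ v) = reduce (u @ v)"
    by simp_all
qed

lemma reduce_cancel_end:
  "reduce (u @ inv_word w @ w) = reduce u" "reduce (u @ w @ inv_word w) = reduce u"
  using reduce_cancel_mid[of u w "[]"] by simp_all

lemma reduce_inner: "reduce (u @ reduce v @ w) = reduce (u @ v @ w)"
  by (metis reduce_reduce_left reduce_reduce_right)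

text \<open>Uniqueness of inverses: append the trivial product of \<open>reduce w\<close> and its
  inverse, then cancel from the other side. The inverse of a reduced word is already
  reduced.\<close>

lemma reduce_inv_word_commute: "reduce (inv_word w) = inv_word (reduce w)"
proof -
  have "reduce (inv_word w) = reduce (inv_word w @ reduce w @ inv_word (reduce w))"
    by (simp add: reduce_cancel_end)
  also have "\<dots> = inv_word (reduce w)"
    unfolding reduce_inner using reduce_cancel_mid(1)[of "[]" w "inv_word (reduce w)"] by simp
  finally show ?thesis .
qed

lemma length_reduce: "length (reduce w) \<le> length w"
proof (induction w)
  case (Cons x w)
  have "length (push x u) \<le> Suc (length u)" for u by (cases u) auto
  then show ?case using Cons by (simp add: reduce_def) (metis Suc_le_mono order_trans)
qed (simp add: reduce_def)

section \<open>Paths, their concatenations and their inverses\<close>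

lemma is_path_append_iff:
  "is_path G u (p @ q) w \<longleftrightarrow> (\<exists>v. is_path G u p v \<and> is_path G v q w)"
  if "is_graph G"
proof
  show "is_path G u (p @ q) w \<Longrightarrow> \<exists>v. is_path G u p v \<and> is_path G v q w"
  proof (induction p arbitrary: u)
    \<comment> \<open>With \<open>p\<close> empty, the membership of \<open>u\<close> in the vertex
      set has to come from the first edge of \<open>q\<close>.\<close>
    case Nil
    then have "u \<in> verts G" using that by (cases q) (auto simp: is_graph_def)
    then show ?case using Nil by auto
  qed auto
qed (auto intro: is_path_append)

lemma is_path_verts: "is_graph G \<Longrightarrow> is_path G u p v \<Longrightarrow> u \<in> verts G \<and> v \<in> verts G"
proof (induction p arbitrary: u)
  case (Cons e p)
  then show ?case by (auto simp: is_graph_def)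
qed auto

lemma is_path_edges: "is_path G u p v \<Longrightarrow> set p \<subseteq> edges G"
  by (induction p arbitrary: u) auto

lemma is_path_bar:
  assumes "is_graph G" "is_path G u p v"
  shows "is_path G v (rev (map (bar G) p)) u"
  using assms(2)
proof (induction p arbitrary: u)
  case (Cons e p)
  then have e: "e \<in> edges G" "init G e = u" by auto
  then have "is_path G (init G (bar G e)) [bar G e] u"
    using assms(1) by (auto simp: is_graph_def)
  moreover have "is_path G v (rev (map (bar G) p)) (init G (bar G e))" using Cons by simp
  ultimately have "is_path G v (rev (map (bar G) p) @ [bar G e]) u" by (rule is_path_append[rotated])
  then show ?case by simp
qed auto

lemma is_path_nth:
  assumes "is_graph G" "is_path G u p v" "i < length p"
  shows "is_path G u (take i p) (init G (p ! i))"
proof -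
  have "is_path G u (take i p @ p ! i # drop (Suc i) p) v"
    using assms(2,3) by (simp add: Cons_nth_drop_Suc)
  then show ?thesis using assms(1) by (auto simp: is_path_append_iff)
qed

lemma map_lab_bar:
  assumes "labeled_graph Y G" "set p \<subseteq> edges G"
  shows "map (lab G) (rev (map (bar G) p)) = inv_word (map (lab G) p)"
proof -
  have "map (lab G) (map (bar G) p) = map inv_letter (map (lab G) p)"
    using assms unfolding list.map_comp by (intro map_cong) (auto simp: labeled_graph_def)
  then show ?thesis by (simp add: inv_word_def rev_map)
qed

section \<open>Reading words in folded graphs\<close>

lemma reads_append:
  "reads G u w v \<Longrightarrow> reads G v w' z \<Longrightarrow> reads G u (w @ w') z"
  unfolding reads_def by (metis is_path_append map_append)

lemma reads_appendE:
  assumes "is_graph G" "reads G u (w @ w') z"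
  obtains v where "reads G u w v" "reads G v w' z"
  using assms by (fastforce simp: reads_def map_eq_append_conv is_path_append_iff)

lemma reads_inv_word:
  assumes "labeled_graph Y G" "reads G u w v"
  shows "reads G v (inv_word w) u"
proof -
  obtain p where p: "is_path G u p v" "map (lab G) p = w" using assms(2) by (auto simp: reads_def)
  show ?thesis
    using is_path_bar[of G u p v] map_lab_bar[OF assms(1) is_path_edges[OF p(1)]] p assms(1)
    unfolding reads_def labeled_graph_def by metis
qed

lemma path_unique:
  assumes "folded G"
  shows "is_path G u p v \<Longrightarrow> is_path G u p' v' \<Longrightarrow> map (lab G) p = map (lab G) p' \<Longrightarrow> p = p'"
proof (induction p arbitrary: u p')
  case (Cons e p)
  then obtain e' q where p': "p' = e' # q" by (cases p') auto
  then have "e = e'" using Cons assms by (auto simp: folded_def)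
  then show ?case using Cons p' by auto
qed auto

lemma is_path_end_unique: "is_path G u p v \<Longrightarrow> is_path G u p v' \<Longrightarrow> v = v'"
  by (induction p arbitrary: u) auto

lemma reads_unique: "folded G \<Longrightarrow> reads G u w v \<Longrightarrow> reads G u w v' \<Longrightarrow> v = v'"
  unfolding reads_def by (metis path_unique is_path_end_unique)

lemma reads_Cons:
  "reads G u (x # w) v \<longleftrightarrow>
     (\<exists>e\<in>edges G. init G e = u \<and> lab G e = x \<and> reads G (init G (bar G e)) w v)"
proof
  assume "reads G u (x # w) v"
  then obtain e p where "is_path G u (e # p) v" "lab G e = x" "map (lab G) p = w"
    by (auto simp: reads_def)
  then show "\<exists>e\<in>edges G. init G e = u \<and> lab G e = x \<and> reads G (init G (bar G e)) w v"
    by (auto simp: reads_def)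
next
  assume "\<exists>e\<in>edges G. init G e = u \<and> lab G e = x \<and> reads G (init G (bar G e)) w v"
  then obtain e p where "is_path G u (e # p) v" "map (lab G) (e # p) = x # w"
    by (auto simp: reads_def)
  then show "reads G u (x # w) v" unfolding reads_def by (intro exI conjI)
qed

lemma reads_push:
  assumes "labeled_graph Y G" "folded G" "reads G u (x # w) v"
  shows "reads G u (push x w) v"
proof (cases "\<exists>w'. w = inv_letter x # w'")
  case True
  then obtain w' where w: "w = inv_letter x # w'" by blast
  obtain e f where e: "e \<in> edges G" "init G e = u" "lab G e = x"
    and f: "f \<in> edges G" "init G f = init G (bar G e)" "lab G f = inv_letter x"
      "reads G (init G (bar G f)) w' v"
    using assms(3) unfolding w reads_Cons by blast
  have "f = bar G e" using assms(1,2) e f by (auto simp: folded_def labeled_graph_def is_graph_def)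
  then show ?thesis using assms(1) e f w by (auto simp: labeled_graph_def is_graph_def)
next
  case False
  then have "push x w = x # w" by (cases w) auto
  then show ?thesis using assms(3) by simp
qed

lemma reads_reduce:
  assumes "labeled_graph Y G" "folded G" "reads G u w v"
  shows "reads G u (reduce w) v"
  using assms(3)
proof (induction w arbitrary: u)
  case (Cons x w)
  then have "reads G u (x # reduce w) v" by (auto simp: reads_Cons)
  from reads_push[OF assms(1,2) this] show ?case by (simp add: reduce_def)
qed (simp add: reduce_def)

text \<open>Going around the loop and then along \<open>w'\<close> ends at \<open>v'\<close>, and
  the word read reduces to \<open>w\<close>. This turns membership in a group of loops into an
  equality of vertices.\<close>

lemma reads_same_end:
  assumes "labeled_graph Y G" "folded G" "reads G z (reduce (w @ inv_word w')) z"
    and "reads G z w v" "reads G z w' v'" "reduced w"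
  shows "v = v'"
proof -
  have "reads G z (reduce (reduce (w @ inv_word w') @ w')) v'"
    using reads_reduce[OF assms(1,2) reads_append[OF assms(3,5)]] .
  then have "reads G z w v'"
    using assms(6) reduce_cancel_mid(1)[of w w' "[]"] by (simp add: reduce_reduce_left)
  then show ?thesis using reads_unique assms by metis
qed

lemma reads_pi1:
  assumes "labeled_graph Y G" "folded G"
  shows "w \<in> pi1 G \<longleftrightarrow> reduced w \<and> reads G (base G) w (base G)"
proof
  assume "w \<in> pi1 G"
  then obtain p where p: "is_path G (base G) p (base G)" "w = reduce (map (lab G) p)"
    by (auto simp: pi1_def path_label_def)
  then have "reads G (base G) (map (lab G) p) (base G)" by (auto simp: reads_def)
  then show "reduced w \<and> reads G (base G) w (base G)" using p reads_reduce[OF assms] by simp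
qed (force simp: pi1_def path_label_def reads_def)

section \<open>Cyclically reduced words\<close>

definition cyc_reduced :: "'x letter list \<Rightarrow> bool" where
  "cyc_reduced c \<longleftrightarrow> c \<noteq> [] \<and> reduced c \<and> hd c \<noteq> inv_letter (last c)"

text \<open>The two junctions, inside the word and across its ends, only exchange roles.\<close>

lemma cyc_reduced_rotate: "cyc_reduced (u @ v) \<longleftrightarrow> cyc_reduced (v @ u)"
  by (cases "u = []"; cases "v = []") (auto simp: cyc_reduced_def reduced_append_iff)

lemma cyc_reduced_inv_word [simp]: "cyc_reduced (inv_word c) \<longleftrightarrow> cyc_reduced c"
  by (cases "c = []") (auto simp: cyc_reduced_def hd_inv_word last_inv_word)

lemma cyclic_reduction:
  assumes "reduced v" "v \<noteq> []"
  obtains p c where "v = p @ c @ inv_word p" "cyc_reduced c"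
proof -
  have "\<exists>p c. v = p @ c @ inv_word p \<and> cyc_reduced c"
    using assms
  proof (induction v rule: length_induct)
    case (1 v)
    show ?case
    proof (cases "hd v = inv_letter (last v)")
      case False
      then show ?thesis using 1 by (intro exI[of _ "[]"] exI[of _ v]) (simp add: cyc_reduced_def)
    next
      case True
      obtain x t where v: "v = x # t" using 1 by (cases v) auto
      then have "t \<noteq> []" using True by auto
      then obtain t' y where t: "t = t' @ [y]" by (metis rev_exhaust)
      have y: "y = inv_letter x" using True v t by auto
      \<comment> \<open>With \<open>t'\<close> empty, \<open>v\<close> would be a letter followed by
        its inverse.\<close>
      have "t' \<noteq> []" using 1(2) v t y by auto
      moreover have "reduced t'" using 1(2) v t reduced_Cons reduced_append1 by blast
      ultimately obtain p c where "t' = p @ c @ inv_word p" "cyc_reduced c"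
        using 1(1)[rule_format, of t'] v t by auto
      then show ?thesis using v t y by (intro exI[of _ "x # p"] exI[of _ c]) simp
    qed
  qed
  then show ?thesis using that by blast
qed

section \<open>Graphs built from labeled arcs\<close>

text \<open>Every natural number is a vertex, so a fresh vertex is always at hand without changing
  the vertex set. An edge carries both of its ends, so the vertices of a path can be read off its
  triples.\<close>

definition triple_graph ::
  "(nat \<times> 'x letter \<times> nat) set \<Rightarrow> (nat, nat \<times> 'x letter \<times> nat, 'x) lgraph" where
  "triple_graph E = \<lparr>verts = UNIV, edges = E, init = fst,
     bar = (\<lambda>(u, x, v). (v, inv_letter x, u)), lab = (\<lambda>(u, x, v). x)\<rparr>"

definition out :: "(nat \<times> 'x letter \<times> nat) set \<Rightarrow> nat \<Rightarrow> 'x letter set" where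
  "out E u = {x. \<exists>v. (u, x, v) \<in> E}"

text \<open>The set \<open>A\<close> contains the start of every edge and, by closure under
  reversal, also the end. Its finiteness is the supply of fresh vertices.\<close>

definition folded_on :: "nat set \<Rightarrow> (nat \<times> 'x letter \<times> nat) set \<Rightarrow> bool" where
  "folded_on A E \<longleftrightarrow> finite A \<and>
     (\<forall>u x v. (u, x, v) \<in> E \<longrightarrow> u \<in> A \<and> (v, inv_letter x, u) \<in> E) \<and>
     (\<forall>u x v v'. (u, x, v) \<in> E \<longrightarrow> (u, x, v') \<in> E \<longrightarrow> v = v')"

lemma folded_on_triple_graph:
  assumes "folded_on A E"
  shows "labeled_graph UNIV (triple_graph E)" "folded (triple_graph E)" "is_graph (triple_graph E)"
proof -
  show g: "is_graph (triple_graph E)" "folded (triple_graph E)"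
    using assms by (auto simp: folded_on_def triple_graph_def folded_def is_graph_def)
  then show "labeled_graph UNIV (triple_graph E)"
    by (auto simp: labeled_graph_def letters_def triple_graph_def)
qed

lemma triple_graph_simps [simp]:
  "init (triple_graph E) = fst" "lab (triple_graph E) (u, x, v) = x"
  "bar (triple_graph E) (u, x, v) = (v, inv_letter x, u)" "edges (triple_graph E) = E"
  "verts (triple_graph E) = UNIV"
  by (simp_all add: triple_graph_def)

lemma triple_path_mono:
  "E \<subseteq> E' \<Longrightarrow> is_path (triple_graph E) u p v \<Longrightarrow> is_path (triple_graph E') u p v"
  by (induction p arbitrary: u) auto

lemma triple_graph_lab_eq [simp]: "lab (triple_graph E) = fst \<circ> snd"
  by (auto simp: triple_graph_def)

text \<open>Distinctness concerns the starting points of the edges, so the end may return to the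
  start: a closed arc is a simple cycle.\<close>

definition arc ::
  "(nat \<times> 'x letter \<times> nat) set \<Rightarrow> nat \<Rightarrow> 'x letter list \<Rightarrow> (nat \<times> 'x letter \<times> nat) list \<Rightarrow> nat \<Rightarrow> bool"
  where
  "arc E u d p v \<longleftrightarrow>
     is_path (triple_graph E) u p v \<and> map (fst \<circ> snd) p = d \<and> distinct (map fst p)"

lemma folded_on_add_edge:
  assumes "folded_on A E" "u \<in> A" "x \<notin> out E u" "inv_letter x \<notin> out E v"
  shows "folded_on (insert v A) (insert (u, x, v) (insert (v, inv_letter x, u) E))"
proof -
  have E: "finite A" "\<And>y l z. (y, l, z) \<in> E \<Longrightarrow> y \<in> A"
    "\<And>y l z. (y, l, z) \<in> E \<Longrightarrow> (z, inv_letter l, y) \<in> E"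
    "\<And>y l z z'. (y, l, z) \<in> E \<Longrightarrow> (y, l, z') \<in> E \<Longrightarrow> z = z'"
    using assms(1) unfolding folded_on_def by blast+
  have new: "(u, x, z) \<notin> E" "(v, inv_letter x, z) \<notin> E" for z
    using assms(3,4) by (auto simp: out_def)
  let ?E = "insert (u, x, v) (insert (v, inv_letter x, u) E)"
  have "z = z'" if "(y, l, z) \<in> ?E" "(y, l, z') \<in> ?E" for y l z z'
    using that new by (elim insertE) (auto intro: E(4))
  moreover have "y \<in> insert v A \<and> (z, inv_letter l, y) \<in> ?E" if "(y, l, z) \<in> ?E" for y l z
    using that assms(2) by (elim insertE) (auto intro: E(2,3))
  ultimately show ?thesis using E(1) unfolding folded_on_def by blast
qed

text \<open>
  The set \<open>A\<close> contains the used vertices, so the interior of the new arc is fresh; the bound on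
  \<open>out\<close> is what makes it possible to attach the next arc without creating a fold.
\<close>

definition adds_arc where
  "adds_arc A E u d v A' E' p \<longleftrightarrow> folded_on A' E' \<and> A \<subseteq> A' \<and> E \<subseteq> E' \<and> arc E' u d p v \<and>
     fst ` set p \<subseteq> A' \<and> fst ` set p \<inter> A \<subseteq> {u} \<and>
     (\<forall>y\<in>A. out E' y \<subseteq> out E y \<union>
        (if y = u then {hd d} else {}) \<union> (if y = v then {inv_letter (last d)} else {}))"

lemma adds_arcD:
  assumes "adds_arc A E u d v A' E' p"
  shows "folded_on A' E'" "A \<subseteq> A'" "E \<subseteq> E'" "arc E' u d p v" "fst ` set p \<subseteq> A'"
    "fst ` set p \<inter> A \<subseteq> {u}"
    "y \<in> A \<Longrightarrow> out E' y \<subseteq> out E y \<union>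
        (if y = u then {hd d} else {}) \<union> (if y = v then {inv_letter (last d)} else {})"
  using assms unfolding adds_arc_def by (elim conjE; simp only:)+

text \<open>The edges are laid down one at a time, each but the last leading to a fresh vertex, so
  among the old vertices only the two ends gain labels. The last hypothesis excludes a fold between
  the two ends of a loop.\<close>

lemma add_arc:
  assumes "folded_on A E" "u \<in> A" "v \<in> A" "reduced d" "d \<noteq> []"
    and "hd d \<notin> out E u" "inv_letter (last d) \<notin> out E v" "u = v \<Longrightarrow> hd d \<noteq> inv_letter (last d)"
  shows "\<exists>A' E' p. adds_arc A E u d v A' E' p"
  using assms
proof (induction d arbitrary: A E u)
  case Nil
  then show ?case by simp
next
  case (Cons x d)
  show ?case
  proof (cases "d = []")
    case True
    let ?E = "insert (u, x, v) (insert (v, inv_letter x, u) E)"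
    have "folded_on A ?E"
      using folded_on_add_edge[of A E u x v] Cons.prems True by (simp add: insert_absorb)
    then have "adds_arc A E u (x # d) v A ?E [(u, x, v)]"
      using Cons.prems True by (auto simp: adds_arc_def out_def arc_def)
    then show ?thesis by blast
  next
    case False
    then obtain y d' where d: "d = y # d'" by (cases d) auto
    have "finite A" using Cons.prems by (simp add: folded_on_def)
    then obtain z where z: "z \<notin> A" using ex_new_if_finite infinite_UNIV_nat by blast
    let ?E = "insert (u, x, z) (insert (z, inv_letter x, u) E)"
    have oz: "out E z = {}" using z Cons.prems(1) by (auto simp: out_def folded_on_def)
    have f: "folded_on (insert z A) ?E"
      using folded_on_add_edge[of A E u x z] Cons.prems oz by simp
    have oz': "out ?E z = {inv_letter x}" using oz z Cons.prems(2) by (auto simp: out_def)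
    have oE: "out ?E w \<subseteq> out E w \<union> (if w = u then {x} else {})" if "w \<in> A" for w
      using that z by (auto simp: out_def)
    have "\<exists>A' E' p. adds_arc (insert z A) ?E z d v A' E' p"
    proof (rule Cons.IH[OF f])
      \<comment> \<open>If \<open>u = v\<close>, the label \<open>x\<close> has just been added at
        \<open>v\<close>; the hypothesis on loops keeps it apart from the final label.\<close>
      show "inv_letter (last d) \<notin> out ?E v"
        using oE[OF Cons.prems(3)] Cons.prems(7,8) False
        by (auto split: if_splits)
      \<comment> \<open>The only label at the fresh vertex is the inverse of \<open>x\<close>, which
        reducedness forbids as the next letter.\<close>
      show "hd d \<notin> out ?E z" using oz' d Cons.prems(4) by auto
      show "z = v \<Longrightarrow> hd d \<noteq> inv_letter (last d)" using z Cons.prems(3) by auto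
      show "reduced d" using Cons.prems(4) by (rule reduced_Cons)
    qed (use Cons.prems False in auto)
    then obtain A' E' p where *: "adds_arc (insert z A) ?E z d v A' E' p" by blast
    note * = adds_arcD[OF *]
    have "out E' w \<subseteq> out E w \<union> (if w = u then {hd (x # d)} else {})
        \<union> (if w = v then {inv_letter (last (x # d))} else {})" if "w \<in> A" for w
    proof -
      have "w \<noteq> z" using that z by auto
      then have "out E' w \<subseteq> out ?E w \<union> (if w = v then {inv_letter (last d)} else {})"
        using *(7)[of w] that by simp
      also have "\<dots> \<subseteq> (out E w \<union> (if w = u then {x} else {})) \<union>
          (if w = v then {inv_letter (last d)} else {})"
        by (rule Un_mono[OF oE[OF that] subset_refl])
      finally show ?thesis by (simp only: list.sel last_ConsR[OF False])
    qed
    moreover have "arc E' u (x # d) ((u, x, z) # p) v"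
      using *(3,4,6) Cons.prems(2) z by (auto simp: arc_def)
    moreover have "fst ` set ((u, x, z) # p) \<subseteq> A'" "fst ` set ((u, x, z) # p) \<inter> A \<subseteq> {u}"
      "folded_on A' E'" "A \<subseteq> A'" "E \<subseteq> E'"
      using *(1-3,5,6) Cons.prems(2) z by auto
    ultimately have "adds_arc A E u (x # d) v A' E' ((u, x, z) # p)"
      unfolding adds_arc_def by blast
    then show ?thesis by blast
  qed
qed

section \<open>Rotation of closed arcs and embedded cycles\<close>

lemma arc_mono: "E \<subseteq> E' \<Longrightarrow> arc E u d p v \<Longrightarrow> arc E' u d p v"
  by (auto simp: arc_def intro: triple_path_mono)

lemma arc_reads: "arc E u d p v \<Longrightarrow> reads (triple_graph E) u d v"
  by (auto simp: arc_def reads_def)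

text \<open>Moves the starting point along \<open>w\<close>. The edges are permuted cyclically, so
  the cycle stays simple; the reading of \<open>w'\<close> records where the new starting point
  lies.\<close>

lemma arc_rotate:
  assumes "folded_on A E" "arc E u (w @ w') p u"
  obtains p' u' where "arc E u' (w' @ w) p' u'" "reads (triple_graph E) u' w' u"
proof -
  from assms(2) obtain p1 p2 where p: "p = p1 @ p2" "map (fst \<circ> snd) p1 = w" "map (fst \<circ> snd) p2 = w'"
    unfolding arc_def by (auto simp: map_eq_append_conv)
  then obtain u' where u': "is_path (triple_graph E) u p1 u'" "is_path (triple_graph E) u' p2 u"
    using assms is_path_append_iff[OF folded_on_triple_graph(3)[OF assms(1)]]
    by (auto simp: arc_def)
  then have "arc E u' (w' @ w) (p2 @ p1) u'"
    using assms(2) p by (auto simp: arc_def intro: is_path_append)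
  then show ?thesis using that u' p by (auto simp: reads_def)
qed

text \<open>The point reached after \<open>w\<close> and \<open>u'\<close> both lead to
  \<open>u\<close> by \<open>w'\<close>; reading \<open>w'\<close> backwards from \<open>u\<close>
  identifies them.\<close>

lemma reads_rotate:
  assumes "labeled_graph Y G" "folded G" "reads G u (w @ w') u" "reads G u' w' u"
  shows "reads G u' (w' @ w) u'"
proof -
  have "is_graph G" using assms(1) by (simp add: labeled_graph_def)
  then obtain z where z: "reads G u w z" "reads G z w' u" using assms(3) by (rule reads_appendE)
  have "z = u'"
    using reads_unique[OF assms(2)] reads_inv_word[OF assms(1)] z(2) assms(4) by metis
  then show ?thesis using reads_append z by metis
qed

text \<open>A certificate for separating prefixes of \<open>c\<close> modulo the subgroup generated
  by c and w d w^-1: both generators are loops at \<open>u\<close>, while distinct proper prefixes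
  of \<open>c\<close> end at distinct vertices.\<close>

definition cycle_embeds :: "'x letter list \<Rightarrow> 'x letter list \<Rightarrow> 'x letter list \<Rightarrow> bool" where
  "cycle_embeds c w d \<longleftrightarrow> (\<exists>A E p u v. folded_on A E \<and> arc E u c p u \<and>
     reads (triple_graph E) u w v \<and> reads (triple_graph E) v d v)"

lemma cycle_embedsI:
  assumes "folded_on A E" "arc E u c p u" "reads (triple_graph E) u w v" "reads (triple_graph E) v d v"
  shows "cycle_embeds c w d"
  using assms unfolding cycle_embeds_def by blast

lemma reads_triple_Nil: "reads (triple_graph E) u [] u"
  by (simp add: reads_def)

lemma folded_on_empty: "finite A \<Longrightarrow> folded_on A {}" "out {} u = {}"
  by (auto simp: folded_on_def out_def)

text \<open>The case without folding: the four inequalities say that neither end of \<open>w\<close>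
  shares a label with the cycle there. The vertices 0 and 1 are reserved in advance for the two
  cycles, and \<open>w\<close> is attached last.\<close>

lemma cycle_embeds_barbell:
  assumes c: "cyc_reduced c" and d: "cyc_reduced d" and w: "reduced w" "w \<noteq> []"
    and "hd w \<noteq> hd c" "hd w \<noteq> inv_letter (last c)"
    and "inv_letter (last w) \<noteq> hd d" "inv_letter (last w) \<noteq> inv_letter (last d)"
  shows "cycle_embeds c w d"
proof -
  have "folded_on {0, 1} {}" by (simp add: folded_on_empty)
  then have "\<exists>A E p. adds_arc {0, 1} {} 0 c 0 A E p"
    by (rule add_arc) (use c in \<open>auto simp: cyc_reduced_def folded_on_empty\<close>)
  then obtain A E p where 1: "adds_arc {0, 1} {} 0 c 0 A E p" by blast
  note 1 = adds_arcD[OF 1]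
  have o1: "out E 0 \<subseteq> {hd c, inv_letter (last c)}" "out E 1 = {}"
    using 1(7)[of 0] 1(7)[of 1] by (auto simp: folded_on_empty)
  have A: "0 \<in> A" "1 \<in> A" using 1(2) by auto
  have "\<exists>A' E' p. adds_arc A E 1 d 1 A' E' p"
    using 1(1) by (rule add_arc) (use d o1 A in \<open>auto simp: cyc_reduced_def\<close>)
  then obtain A' E' p' where 2: "adds_arc A E 1 d 1 A' E' p'" by blast
  note 2 = adds_arcD[OF 2]
  have o2: "out E' 0 \<subseteq> {hd c, inv_letter (last c)}" "out E' 1 \<subseteq> {hd d, inv_letter (last d)}"
    using 2(7)[OF A(1)] 2(7)[OF A(2)] o1 by auto
  have "\<exists>A'' E'' p. adds_arc A' E' 0 w 1 A'' E'' p"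
    by (rule add_arc) (use 2(1,2) A w o2 assms in auto)
  then obtain A'' E'' p'' where 3: "adds_arc A' E' 0 w 1 A'' E'' p''" by blast
  note 3 = adds_arcD[OF 3]
  have "arc E'' 0 c p 0" using 1(4) 2(3) 3(3) by (auto intro: arc_mono)
  moreover have "arc E'' 1 d p' 1" using 2(4) 3(3) by (auto intro: arc_mono)
  ultimately show ?thesis
    using cycle_embedsI[OF 3(1) _ arc_reads[OF 3(4)]] arc_reads by blast
qed

text \<open>Two arcs \<open>d1\<close> and \<open>d2\<close> run from 0 to 1 and share the return
  arc \<open>q\<close>. If \<open>q\<close> is empty the two vertices merge and the graph is a wedge
  of two loops; the last hypothesis then keeps the start of each loop apart from the end of the
  other.\<close>

lemma theta_graph:
  assumes c: "cyc_reduced (d1 @ q)" "cyc_reduced (d2 @ q)" and ne: "d1 \<noteq> []" "d2 \<noteq> []"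
    and hd: "hd d1 \<noteq> hd d2" and last: "last d1 \<noteq> last d2"
    and q: "q = [] \<Longrightarrow> hd d1 \<noteq> inv_letter (last d2) \<and> hd d2 \<noteq> inv_letter (last d1)"
  shows "\<exists>A E p u. folded_on A E \<and> arc E u (d1 @ q) p u \<and> reads (triple_graph E) u (d2 @ q) u"
proof (cases "q = []")
  case True
  have "folded_on {0} {}" by (simp add: folded_on_empty)
  then have "\<exists>A E p. adds_arc {0} {} 0 d1 0 A E p"
    by (rule add_arc) (use c True in \<open>auto simp: cyc_reduced_def folded_on_empty\<close>)
  then obtain A E p where 1: "adds_arc {0} {} 0 d1 0 A E p" by blast
  note 1 = adds_arcD[OF 1]
  have o1: "out E 0 \<subseteq> {hd d1, inv_letter (last d1)}" using 1(7)[of 0] by (auto simp: folded_on_empty)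
  have "\<exists>A' E' p. adds_arc A E 0 d2 0 A' E' p"
    using 1(1) by (rule add_arc)
      (use 1(2) c True o1 q hd last in \<open>auto simp: cyc_reduced_def inv_letter_eq_iff\<close>)
  then obtain A' E' p' where 2: "adds_arc A E 0 d2 0 A' E' p'" by blast
  note 2 = adds_arcD[OF 2]
  have "arc E' 0 d1 p 0" using 1(4) 2(3) by (auto intro: arc_mono)
  then show ?thesis using 2(1) arc_reads[OF 2(4)] unfolding True append_Nil2 by blast
next
  case False
  have hq: "hd q \<noteq> inv_letter (last d1)" "hd q \<noteq> inv_letter (last d2)" "reduced q"
    "reduced d1" "reduced d2"
    and lq: "inv_letter (last q) \<noteq> hd d1" "inv_letter (last q) \<noteq> hd d2"
    using c False ne by (auto simp: cyc_reduced_def reduced_append_iff)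
  have "folded_on {0, 1} {}" by (simp add: folded_on_empty)
  then have "\<exists>A E p. adds_arc {0, 1} {} 0 d1 1 A E p"
    by (rule add_arc) (use hq ne in \<open>auto simp: folded_on_empty\<close>)
  then obtain A E p where 1: "adds_arc {0, 1} {} 0 d1 1 A E p" by blast
  note 1 = adds_arcD[OF 1]
  have o1: "out E 0 \<subseteq> {hd d1}" "out E 1 \<subseteq> {inv_letter (last d1)}"
    using 1(7)[of 0] 1(7)[of 1] by (auto simp: folded_on_empty)
  have A: "0 \<in> A" "1 \<in> A" using 1(2) by auto
  have "\<exists>A' E' p. adds_arc A E 0 d2 1 A' E' p"
    using 1(1) by (rule add_arc)
      (use A hq ne o1 hd last in \<open>auto simp: inv_letter_eq_iff\<close>)
  then obtain A' E' p' where 2: "adds_arc A E 0 d2 1 A' E' p'" by blast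
  note 2 = adds_arcD[OF 2]
  have A': "0 \<in> A'" "1 \<in> A'" using A 2(2) by auto
  have o2: "out E' 0 \<subseteq> {hd d1, hd d2}" "out E' 1 \<subseteq> {inv_letter (last d1), inv_letter (last d2)}"
    using 2(7)[OF A(1)] 2(7)[OF A(2)] o1 by auto
  have "\<exists>A'' E'' p. adds_arc A' E' 1 q 0 A'' E'' p"
    using 2(1) by (rule add_arc) (use A' hq lq o2 False in auto)
  then obtain A'' E'' p'' where 3: "adds_arc A' E' 1 q 0 A'' E'' p''" by blast
  note 3 = adds_arcD[OF 3]
  have a: "arc E'' 0 d1 p 1" "arc E'' 0 d2 p' 1"
    using 1(4) 2(3,4) 3(3) by (auto intro: arc_mono)
  \<comment> \<open>The first arc starts its edges at 0 or at new vertices, the return arc at 1 or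
    at vertices newer still; hence together they form a simple cycle.\<close>
  have "1 \<notin> fst ` set p" using 1(6) by auto
  moreover have "x = 1" if "x \<in> fst ` set p" "x \<in> fst ` set p''" for x
    using that 1(5) 2(2) 3(6) by (meson Int_iff singletonD subsetD)
  ultimately have "fst ` set p \<inter> fst ` set p'' = {}" by (metis disjoint_iff)
  then have "arc E'' 0 (d1 @ q) (p @ p'') 0"
    using a(1) 3(4) by (auto simp: arc_def intro: is_path_append)
  moreover have "reads (triple_graph E'') 0 (d2 @ q) 0"
    using a(2) 3(4) by (auto intro: reads_append arc_reads)
  ultimately show ?thesis using 3(1) by blast
qed

text \<open>Strip the longest common prefix and then the longest common suffix of the rest. Equal
  lengths ensure that a differing letter is found on both sides.\<close>

lemma different_middles:
  assumes "length c = length d" "c \<noteq> d"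
  obtains p c' d' s where "c = p @ c' @ s" "d = p @ d' @ s" "c' \<noteq> []" "d' \<noteq> []"
    "hd c' \<noteq> hd d'" "last c' \<noteq> last d'"
proof -
  obtain p x c1 y d1 where 1: "x \<noteq> y" "c = p @ [x] @ c1" "d = p @ [y] @ d1"
    using same_length_different[OF assms(2,1)] by blast
  \<comment> \<open>Reversal turns the last difference into a first one. It may coincide with the
    difference already found, in which case the middles are single letters.\<close>
  have len: "length (rev (x # c1)) = length (rev (y # d1))" and ne: "rev (x # c1) \<noteq> rev (y # d1)"
    using 1 assms(1) by auto
  obtain s x' c2 y' d2 where 2: "x' \<noteq> y'" "rev (x # c1) = s @ [x'] @ c2" "rev (y # d1) = s @ [y'] @ d2"
    using same_length_different[OF ne len] by blast
  have 3: "x # c1 = (rev c2 @ [x']) @ rev s" "y # d1 = (rev d2 @ [y']) @ rev s"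
    using 2(2,3)[THEN arg_cong[where f = rev]] by simp_all
  then have h: "hd (rev c2 @ [x']) = x" "hd (rev d2 @ [y']) = y"
    by (metis Nil_is_append_conv hd_append2 list.sel(1) not_Cons_self2)+
  show ?thesis
  proof (rule that)
    show "c = p @ (rev c2 @ [x']) @ rev s" "d = p @ (rev d2 @ [y']) @ rev s"
      using 1(2,3) 3 by simp_all
  qed (use h 1(1) 2(1) in simp_all)
qed

text \<open>
  Folding the common prefix and suffix of \<open>c = p c' s\<close> and \<open>d = p d' s\<close> gives a theta graph, in which
  \<open>c'\<close> and \<open>d'\<close> are nonempty because the lengths agree.
\<close>

lemma cycle_embeds_wedge_noninverse:
  assumes c: "cyc_reduced c" "cyc_reduced d" "length c = length d" "c \<noteq> d"
    and h: "hd c = hd d \<or> last c = last d \<or> (hd c \<noteq> inv_letter (last d) \<and> hd d \<noteq> inv_letter (last c))"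
  shows "cycle_embeds c [] d"
proof -
  obtain p c' d' s where *: "c = p @ c' @ s" "d = p @ d' @ s" "c' \<noteq> []" "d' \<noteq> []"
    "hd c' \<noteq> hd d'" "last c' \<noteq> last d'"
    using different_middles[OF c(3,4)] .
  have "cyc_reduced (c' @ s @ p)" "cyc_reduced (d' @ s @ p)"
    using c * cyc_reduced_rotate[of p "c' @ s"] cyc_reduced_rotate[of p "d' @ s"] by simp_all
  \<comment> \<open>The shared arc is \<open>s @ p\<close>. If it is empty, the words differ in both
    their first and last letters, so \<open>h\<close> leaves just the alternative that
    \<open>theta_graph\<close> asks for.\<close>
  then have "\<exists>A E q u. folded_on A E \<and> arc E u (c' @ s @ p) q u \<and>
      reads (triple_graph E) u (d' @ s @ p) u"
    by (rule theta_graph) (use * h in auto)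
  then obtain A E q u where E: "folded_on A E" "arc E u ((c' @ s) @ p) q u"
      "reads (triple_graph E) u ((d' @ s) @ p) u"
    by auto
  \<comment> \<open>Rotating back along \<open>p\<close> restores the original starting point of
    both cycles.\<close>
  obtain q' u' where u': "arc E u' (p @ c' @ s) q' u'" "reads (triple_graph E) u' p u"
    using arc_rotate[OF E(1,2)] .
  have "reads (triple_graph E) u' (p @ d' @ s) u'"
    using reads_rotate[OF folded_on_triple_graph(1,2)[OF E(1)] E(3) u'(2)] by simp
  then show ?thesis
    unfolding * by (rule cycle_embedsI[OF E(1) u'(1) reads_triple_Nil])
qed

text \<open>A loop can be read in either direction, so \<open>d\<close> may be replaced by its
  inverse when the cycles overlap with opposite orientations. If \<open>c\<close> equals
  \<open>d\<close> or its inverse, a single cycle serves as the graph.\<close>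

lemma cycle_embeds_wedge:
  assumes c: "cyc_reduced c" "cyc_reduced d" "length c = length d"
  shows "cycle_embeds c [] d"
proof -
  have inv: "cycle_embeds c [] d" if "cycle_embeds c [] (inv_word d)"
  proof -
    obtain A E p u v where E: "folded_on A E" "arc E u c p u" "reads (triple_graph E) u [] v"
      "reads (triple_graph E) v (inv_word d) v"
      using \<open>cycle_embeds c [] (inv_word d)\<close> unfolding cycle_embeds_def by blast
    show ?thesis
      using cycle_embedsI[OF E(1-3)] reads_inv_word[OF folded_on_triple_graph(1)[OF E(1)] E(4)] by simp
  qed
  have same: "cycle_embeds c [] c"
  proof -
    have "folded_on {0} {}" by (simp add: folded_on_empty)
    then have "\<exists>A E p. adds_arc {0} {} 0 c 0 A E p"
      by (rule add_arc) (use c in \<open>auto simp: cyc_reduced_def folded_on_empty\<close>)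
    then obtain A E p where 1: "adds_arc {0} {} 0 c 0 A E p" by blast
    show ?thesis
      by (rule cycle_embedsI[OF adds_arcD(1,4)[OF 1] reads_triple_Nil arc_reads[OF adds_arcD(4)[OF 1]]])
  qed
  have ne: "c \<noteq> []" "d \<noteq> []" using c by (auto simp: cyc_reduced_def)
  consider "c = d" | "c = inv_word d" | "c \<noteq> d" "c \<noteq> inv_word d" by blast
  then show ?thesis
  proof cases
    case 3
    show ?thesis
    proof (cases "hd c = inv_letter (last d) \<or> hd d = inv_letter (last c)")
      case True
      then have "cycle_embeds c [] (inv_word d)"
        using c 3 ne by (intro cycle_embeds_wedge_noninverse) (auto simp: hd_inv_word last_inv_word)
      then show ?thesis by (rule inv)
    next
      case False
      then show ?thesis using c 3 by (intro cycle_embeds_wedge_noninverse) auto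
    qed
  qed (use same inv in auto)
qed

text \<open>Induction on \<open>w\<close>: an end of \<open>w\<close> that would fold into a cycle
  is absorbed by rotating that cycle, which shortens \<open>w\<close> and preserves lengths. When
  neither end folds, the graph is a barbell. The two cycles are rotated independently, so the
  statement must allow different words \<open>c\<close> and \<open>d\<close>.\<close>

theorem cycle_embeds:
  assumes "cyc_reduced c" "cyc_reduced d" "length c = length d" "reduced w"
  shows "cycle_embeds c w d"
  using assms
proof (induction "length w" arbitrary: w c d)
  case 0
  then show ?case using cycle_embeds_wedge by auto
next
  case (Suc n)
  then have w: "w \<noteq> []" by auto
  have ne: "c \<noteq> []" "d \<noteq> []" using Suc by (auto simp: cyc_reduced_def)
  consider "hd w = hd c" | "hd w = inv_letter (last c)" | "inv_letter (last w) = hd d"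
    | "last w = last d"
    | "hd w \<noteq> hd c" "hd w \<noteq> inv_letter (last c)"
    "inv_letter (last w) \<noteq> hd d" "last w \<noteq> last d" by blast
  then show ?case
  proof cases
    case 1
    then obtain x t w' where *: "c = x # t" "w = x # w'"
      using w ne by (metis list.collapse)
    have "cycle_embeds (t @ [x]) w' d"
    proof (rule Suc.hyps)
      show "cyc_reduced (t @ [x])" using Suc * cyc_reduced_rotate[of "[x]" t] by simp
      show "reduced w'" using Suc * reduced_Cons by blast
    qed (use Suc * in auto)
    then obtain A E p u v where E: "folded_on A E" "arc E u (t @ [x]) p u"
      "reads (triple_graph E) u w' v" "reads (triple_graph E) v d v"
      unfolding cycle_embeds_def by blast
    obtain p' u' where u': "arc E u' ([x] @ t) p' u'" "reads (triple_graph E) u' [x] u"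
      using arc_rotate[OF E(1,2)] .
    have "reads (triple_graph E) u' w v" using reads_append[OF u'(2) E(3)] * by simp
    then show ?thesis using cycle_embedsI[OF E(1) _ _ E(4)] u' * by simp
  next
    case 2
    obtain t y where t: "c = t @ [y]" using ne by (metis rev_exhaust)
    then obtain w' where *: "w = inv_letter y # w'"
      using w 2 by (metis list.collapse last_snoc)
    have "cycle_embeds ([y] @ t) w' d"
    proof (rule Suc.hyps)
      show "cyc_reduced ([y] @ t)" using Suc t cyc_reduced_rotate[of "[y]" t] by simp
      show "reduced w'" using Suc * reduced_Cons by blast
    qed (use Suc * t in auto)
    then obtain A E p u v where E: "folded_on A E" "arc E u ([y] @ t) p u"
      "reads (triple_graph E) u w' v" "reads (triple_graph E) v d v"
      unfolding cycle_embeds_def by blast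
    note tg = folded_on_triple_graph[OF E(1)]
    obtain p' u' where u': "arc E u' (t @ [y]) p' u'" "reads (triple_graph E) u' t u"
      using arc_rotate[OF E(1,2)] .
    \<comment> \<open>Since \<open>t\<close> leads from \<open>u'\<close> to \<open>u\<close> and
      the cycle closes with \<open>y\<close>, the inverse of \<open>y\<close> leads from
      \<open>u'\<close> to \<open>u\<close>; this is the removed first letter of
      \<open>w\<close>.\<close>
    obtain z where "reads (triple_graph E) u' t z" "reads (triple_graph E) z [y] u'"
      using reads_appendE[OF tg(3) arc_reads[OF u'(1)]] .
    then have "reads (triple_graph E) u' (inv_word [y]) u"
      using reads_unique[OF tg(2)] u'(2) reads_inv_word[OF tg(1)] by metis
    then have "reads (triple_graph E) u' w v"
      using reads_append[OF _ E(3)] * by fastforce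
    then show ?thesis using cycle_embedsI[OF E(1) _ _ E(4)] u' t by simp
  next
    case 3
    obtain w' x where *: "w = w' @ [x]" using w by (metis rev_exhaust)
    then obtain t where t: "d = inv_letter x # t"
      using ne 3 by (metis list.collapse last_snoc)
    have "cycle_embeds c w' (t @ [inv_letter x])"
    proof (rule Suc.hyps)
      show "cyc_reduced (t @ [inv_letter x])"
        using Suc t cyc_reduced_rotate[of "[inv_letter x]" t] by simp
      show "reduced w'" using Suc * reduced_append1 by blast
    qed (use Suc * t in auto)
    then obtain A E p u v where E: "folded_on A E" "arc E u c p u"
      "reads (triple_graph E) u w' v" "reads (triple_graph E) v (t @ [inv_letter x]) v"
      unfolding cycle_embeds_def by blast
    note tg = folded_on_triple_graph[OF E(1)]
    \<comment> \<open>The far cycle is entered one edge earlier, at the vertex from which the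
      inverse of \<open>x\<close> leads to \<open>v\<close>.\<close>
    obtain z where z: "reads (triple_graph E) v t z" "reads (triple_graph E) z [inv_letter x] v"
      using reads_appendE[OF tg(3) E(4)] .
    have "reads (triple_graph E) v [x] z" using reads_inv_word[OF tg(1) z(2)] by simp
    then have "reads (triple_graph E) u w z" using reads_append[OF E(3)] * by simp
    moreover have "reads (triple_graph E) z d z" using reads_append[OF z(2,1)] t by simp
    ultimately show ?thesis by (rule cycle_embedsI[OF E(1,2)])
  next
    case 4
    obtain w' x where *: "w = w' @ [x]" using w by (metis rev_exhaust)
    then obtain t where t: "d = t @ [x]"
      using ne 4 by (metis last_snoc append_butlast_last_id)
    have "cycle_embeds c w' ([x] @ t)"
    proof (rule Suc.hyps)
      show "cyc_reduced ([x] @ t)" using Suc t cyc_reduced_rotate[of "[x]" t] by simp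
      show "reduced w'" using Suc * reduced_append1 by blast
    qed (use Suc * t in auto)
    then obtain A E p u v where E: "folded_on A E" "arc E u c p u"
      "reads (triple_graph E) u w' v" "reads (triple_graph E) v ([x] @ t) v"
      unfolding cycle_embeds_def by blast
    note tg = folded_on_triple_graph[OF E(1)]
    obtain z where z: "reads (triple_graph E) v [x] z" "reads (triple_graph E) z t v"
      using reads_appendE[OF tg(3) E(4)] .
    have "reads (triple_graph E) u w z" using reads_append[OF E(3) z(1)] * by simp
    moreover have "reads (triple_graph E) z d z" using reads_append[OF z(2,1)] t by simp
    ultimately show ?thesis by (rule cycle_embedsI[OF E(1,2)])
  next
    case 5
    then show ?thesis
      using Suc w by (intro cycle_embeds_barbell) (auto simp: inv_letter_eq_iff)
  qed
qed

section \<open>The fundamental group of a subdivided graph\<close>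

lemma is_graphD:
  assumes "is_graph G" "e \<in> edges G"
  shows "init G e \<in> verts G" "bar G e \<in> edges G" "bar G (bar G e) = e" "bar G e \<noteq> e"
  using assms by (auto simp: is_graph_def)

lemma labeled_graphD:
  assumes "labeled_graph Y G"
  shows "is_graph G" "e \<in> edges G \<Longrightarrow> lab G e \<in> letters Y"
    "e \<in> edges G \<Longrightarrow> lab G (bar G e) = inv_letter (lab G e)"
  using assms by (auto simp: labeled_graph_def)

lemma letters_is_path:
  assumes "labeled_graph Y G" "is_path G u p v"
  shows "set (map (lab G) p) \<subseteq> letters Y"
  using labeled_graphD(2)[OF assms(1)] is_path_edges[OF assms(2)] by auto

locale nondegenerate =
  fixes Y :: "'y set" and X :: "'x set" and \<phi> :: "'y letter list \<Rightarrow> 'x letter list"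
    and G :: "('v, 'e, 'y) pgraph"
  assumes hom: "\<phi> \<in> hom (free_group Y) (free_group X)"
    and nontrivial: "y \<in> Y \<Longrightarrow> \<phi> (gen y) \<noteq> []"
    and labeled: "labeled_graph Y G"
begin

text \<open>The homomorphism property prescribes \<phi> on reduced words over \<open>Y\<close>, so
  arbitrary words are passed through \<open>reduce\<close> first.\<close>

lemma phi_closed:
  assumes "set w \<subseteq> letters Y"
  shows "set (\<phi> (reduce w)) \<subseteq> letters X" "reduced (\<phi> (reduce w))"
  using hom_in_carrier[OF hom, of "reduce w"] set_reduce[of w] assms by auto

lemma phi_append:
  assumes "set w \<subseteq> letters Y" "set w' \<subseteq> letters Y"
  shows "\<phi> (reduce (w @ w')) = reduce (\<phi> (reduce w) @ \<phi> (reduce w'))"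
proof -
  have "\<phi> (reduce w \<otimes>\<^bsub>free_group Y\<^esub> reduce w') = \<phi> (reduce w) \<otimes>\<^bsub>free_group X\<^esub> \<phi> (reduce w')"
    using assms set_reduce[of w] set_reduce[of w'] by (intro hom_mult[OF hom]) auto
  then show ?thesis by (simp add: reduce_reduce_left reduce_reduce_right)
qed

lemma phi_inv:
  assumes "set w \<subseteq> letters Y"
  shows "\<phi> (reduce (inv_word w)) = inv_word (\<phi> (reduce w))"
proof -
  interpret group_hom "free_group Y" "free_group X" \<phi>
    by (intro group_hom.intro group_hom_axioms.intro group_free_group hom)
  let ?r = "reduce w"
  have r: "?r \<in> carrier (free_group Y)" using assms set_reduce[of w] by auto
  show ?thesis
    using hom_inv[OF r] inv_free_group[OF r] inv_free_group[OF hom_closed[OF r]]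
    by (simp add: reduce_inv_word_commute)
qed

lemma phi_Nil: "\<phi> [] = []"
  using phi_append[of "[]" "[]"] phi_closed[of "[]"]
  by (metis append_Nil2 empty_subsetI inv_word_simps(1) list.set(1) phi_inv reduce_inv_word
      reduce_id reduced_simps(1))

abbreviation "F \<equiv> F_graph \<phi> G"

lemma F_word:
  assumes "e \<in> edges G"
  shows "set (F_word \<phi> G e) \<subseteq> letters X" "reduced (F_word \<phi> G e)"
    "F_word \<phi> G (bar G e) = inv_word (F_word \<phi> G e)"
  using phi_closed[of "[lab G e]"] phi_inv[of "[lab G e]"] labeled_graphD[OF labeled] assms
  by (auto simp: F_word_def)

lemma F_word_nonempty: "e \<in> edges G \<Longrightarrow> snd (lab G e) \<Longrightarrow> F_word \<phi> G e \<noteq> []"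
  using nontrivial[of "fst (lab G e)"] labeled_graphD(2)[OF labeled, of e]
  by (cases "lab G e") (auto simp: F_word_def gen_def letters_def)

lemma F_simps:
  "verts F = Old ` verts G \<union>
     {Inner e i | e i. e \<in> edges G \<and> snd (lab G e) \<and> 0 < i \<and> i < length (F_word \<phi> G e)}"
  "(e, i, s) \<in> edges F \<longleftrightarrow> e \<in> edges G \<and> snd (lab G e) \<and> i < length (F_word \<phi> G e)"
  "init F (e, i, s) = F_pos \<phi> G e (if s then i else Suc i)"
  "bar F (e, i, s) = (e, i, \<not> s)"
  "lab F (e, i, s) = (if s then F_word \<phi> G e ! i else inv_letter (F_word \<phi> G e ! i))"
  "base F = Old (base G)"
  by (auto simp: F_graph_def)

lemma F_pos_verts:
  assumes "e \<in> edges G" "snd (lab G e)" "i \<le> length (F_word \<phi> G e)"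
  shows "F_pos \<phi> G e i \<in> verts F"
  using assms is_graphD[OF labeled_graphD(1)[OF labeled] assms(1)]
    is_graphD(1)[OF labeled_graphD(1)[OF labeled], of "bar G e"]
  by (auto simp: F_simps F_pos_def)

lemma labeled_F: "labeled_graph X F"
  unfolding labeled_graph_def is_graph_def
proof (intro conjI ballI; clarify)
  fix e i s assume "(e, i, s) \<in> edges F"
  then have e: "e \<in> edges G" "snd (lab G e)" "i < length (F_word \<phi> G e)" by (auto simp: F_simps)
  show "init F (e, i, s) \<in> verts F" using F_pos_verts[OF e(1,2)] e(3) by (auto simp: F_simps)
  show "bar F (e, i, s) \<in> edges F" "bar F (bar F (e, i, s)) = (e, i, s)" using e by (auto simp: F_simps)
  show "bar F (e, i, s) = (e, i, s) \<Longrightarrow> False" by (simp add: F_simps)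
  have "F_word \<phi> G e ! i \<in> letters X" using F_word(1)[OF e(1)] e(3) by auto
  then show "lab F (e, i, s) \<in> letters X" by (simp add: F_simps)
  show "lab F (bar F (e, i, s)) = inv_letter (lab F (e, i, s))" by (simp add: F_simps)
qed

text \<open>
  Invariant for following a path in \<open>F\<close>: its label is homotopic to that of a subdivided path of \<open>G\<close>
  followed by the part of the current edge that has been traversed.
\<close>

fun lifts :: "'v \<Rightarrow> ('v, 'e) fvertex \<Rightarrow> 'x letter list \<Rightarrow> bool" where
  "lifts z (Old u) w \<longleftrightarrow> (\<exists>p. is_path G z p u \<and> w = \<phi> (path_label G p))"
| "lifts z (Inner e i) w \<longleftrightarrow> (\<exists>p. is_path G z p (init G e) \<and>
     w = reduce (\<phi> (path_label G p) @ take i (F_word \<phi> G e)))"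

lemma phi_path_snoc:
  assumes "is_path G z p (init G e)" "e \<in> edges G"
  shows "is_path G z (p @ [e]) (init G (bar G e))"
    "\<phi> (path_label G (p @ [e])) = reduce (\<phi> (path_label G p) @ F_word \<phi> G e)"
proof -
  have "is_path G (init G e) [e] (init G (bar G e))"
    using assms(2) is_graphD[OF labeled_graphD(1)[OF labeled]] by auto
  then show "is_path G z (p @ [e]) (init G (bar G e))" by (rule is_path_append[OF assms(1)])
  show "\<phi> (path_label G (p @ [e])) = reduce (\<phi> (path_label G p) @ F_word \<phi> G e)"
    using phi_append[OF letters_is_path[OF labeled assms(1)], of "[lab G e]"]
      labeled_graphD(2)[OF labeled assms(2)] by (simp add: path_label_def F_word_def)
qed

lemma phi_path_reduced: "is_path G z p u \<Longrightarrow> reduced (\<phi> (path_label G p))"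
  using phi_closed(2)[OF letters_is_path[OF labeled]] by (simp add: path_label_def)

text \<open>Treats old and inner vertices uniformly. At the far end of \<open>e\<close> the two
  descriptions differ by one traversal: append \<open>e\<close> in one direction, its reverse in the
  other, where the labels cancel.\<close>

lemma lifts_F_pos:
  assumes e: "e \<in> edges G" "snd (lab G e)" "i \<le> length (F_word \<phi> G e)"
  shows "lifts z (F_pos \<phi> G e i) w \<longleftrightarrow> (\<exists>p. is_path G z p (init G e) \<and>
     w = reduce (\<phi> (path_label G p) @ take i (F_word \<phi> G e)))"
proof -
  note g = is_graphD[OF labeled_graphD(1)[OF labeled] e(1)]
  consider "i = 0" | "0 < i" "i < length (F_word \<phi> G e)"
    | "0 < i" "i = length (F_word \<phi> G e)" using e(3) by linarith
  then show ?thesis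
  proof cases
    case 1
    then show ?thesis using phi_path_reduced by (auto simp: F_pos_def)
  next
    case 3
    have "\<exists>q. is_path G z q (init G e) \<and> \<phi> (path_label G p) = reduce (\<phi> (path_label G q) @ F_word \<phi> G e)"
      if "is_path G z p (init G (bar G e))" for p
    proof (intro exI conjI)
      show "is_path G z (p @ [bar G e]) (init G e)" using phi_path_snoc(1)[OF that g(2)] g by simp
      show "\<phi> (path_label G p) = reduce (\<phi> (path_label G (p @ [bar G e])) @ F_word \<phi> G e)"
        using phi_path_snoc(2)[OF that g(2)] F_word(3)[OF e(1)] phi_path_reduced[OF that]
          reduce_cancel_mid(1)[of "\<phi> (path_label G p)" "F_word \<phi> G e" "[]"]
        by (simp add: reduce_reduce_left)
    qed
    moreover have "\<exists>p. is_path G z p (init G (bar G e)) \<and>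
        \<phi> (path_label G p) = reduce (\<phi> (path_label G q) @ F_word \<phi> G e)"
      if "is_path G z q (init G e)" for q
      using phi_path_snoc[OF that e(1)] by blast
    ultimately show ?thesis using 3 by (auto simp: F_pos_def) metis+
  qed (auto simp: F_pos_def)
qed

text \<open>A forward edge adds one letter to the traversed part of the current edge; a backward
  edge cancels its last letter.\<close>

lemma lifts_step:
  assumes "lifts z (init F f) w" "f \<in> edges F"
  shows "lifts z (init F (bar F f)) (reduce (w @ [lab F f]))"
proof -
  obtain e i s where f: "f = (e, i, s)" by (cases f)
  then have e: "e \<in> edges G" "snd (lab G e)" "i < length (F_word \<phi> G e)"
    using assms(2) by (auto simp: F_simps)
  let ?x = "F_word \<phi> G e ! i"
  have t: "take (Suc i) (F_word \<phi> G e) = take i (F_word \<phi> G e) @ [?x]"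
    using e(3) by (rule take_Suc_conv_app_nth)
  have "reduce (u @ t @ [?x, inv_letter ?x]) = reduce (u @ t)" for u t
    using reduce_cancel_mid(2)[of "u @ t" "[?x]" "[]"] by simp
  then show ?thesis
    using assms(1) e f t
    by (cases s) (auto simp: F_simps lifts_F_pos reduce_reduce_left)
qed

lemma lifts_path:
  "is_path F x p x' \<Longrightarrow> lifts z x w \<Longrightarrow> reduced w \<Longrightarrow> lifts z x' (reduce (w @ map (lab F) p))"
proof (induction p arbitrary: x w)
  case (Cons f p)
  then have "lifts z (init F (bar F f)) (reduce (w @ [lab F f]))" by (auto intro: lifts_step)
  then have "lifts z x' (reduce (reduce (w @ [lab F f]) @ map (lab F) p))"
    using Cons by auto
  then show ?case by (simp add: reduce_reduce_left)
qed auto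

lemma reads_F_prefix:
  assumes "e \<in> edges G" "snd (lab G e)" "i \<le> length (F_word \<phi> G e)"
  shows "reads F (Old (init G e)) (take i (F_word \<phi> G e)) (F_pos \<phi> G e i)"
  using assms(3)
proof (induction i)
  case 0
  show ?case using F_pos_verts[OF assms(1,2), of 0] by (simp add: reads_def F_pos_def)
next
  case (Suc i)
  let ?f = "(e, i, True)"
  have "is_path F (F_pos \<phi> G e i) [?f] (F_pos \<phi> G e (Suc i))"
    using assms Suc.prems F_pos_verts[OF assms(1,2) Suc.prems] by (simp add: F_simps)
  then have "reads F (F_pos \<phi> G e i) [F_word \<phi> G e ! i] (F_pos \<phi> G e (Suc i))"
    unfolding reads_def by (intro exI[of _ "[?f]"]) (simp add: F_simps)
  then show ?case
    using reads_append Suc by (fastforce simp: take_Suc_conv_app_nth)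
qed

lemma reads_F_edge:
  assumes "e \<in> edges G"
  shows "reads F (Old (init G e)) (F_word \<phi> G e) (Old (init G (bar G e)))"
proof -
  have pos: "reads F (Old (init G e)) (F_word \<phi> G e) (Old (init G (bar G e)))"
    if "e \<in> edges G" "snd (lab G e)" for e
    using reads_F_prefix[OF that order_refl] F_word_nonempty[OF that] by (simp add: F_pos_def)
  show ?thesis
  proof (cases "snd (lab G e)")
    \<comment> \<open>An edge with a negative label has no subdivision of its own; it is read
      backwards along that of its reverse.\<close>
    case False
    note g = is_graphD[OF labeled_graphD(1)[OF labeled] assms]
    have "snd (lab G (bar G e))"
      using False labeled_graphD(3)[OF labeled assms] by (simp add: inv_letter_def)
    from reads_inv_word[OF labeled_F pos[OF g(2) this]]
    show ?thesis using g F_word(3)[OF assms] by simp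
  qed (use pos assms in blast)
qed

lemma reads_F_path:
  assumes "is_path G u p v"
  shows "\<exists>w. reads F (Old u) w (Old v) \<and> reduce w = \<phi> (path_label G p)"
  using assms
proof (induction p arbitrary: v rule: rev_induct)
  case Nil
  then show ?case
    by (intro exI[of _ "[]"]) (auto simp: reads_def F_simps path_label_def phi_Nil)
next
  case (snoc e p)
  then have e: "is_path G u p (init G e)" "e \<in> edges G" "v = init G (bar G e)"
    using is_path_append_iff[OF labeled_graphD(1)[OF labeled]] by auto
  then obtain w where w: "reads F (Old u) w (Old (init G e))" "reduce w = \<phi> (path_label G p)"
    using snoc.IH by blast
  show ?case
    using reads_append[OF w(1) reads_F_edge[OF e(2)]] e(3) w(2) phi_path_snoc(2)[OF e(1,2)]
      reduce_reduce_left[of w]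
    by metis
qed

text \<open>The invariant \<open>lifts\<close> starts with the empty word and, when a loop returns
  to the base point, exhibits its label as an image under \<phi>. Conversely every loop of
  \<open>G\<close> can be subdivided.\<close>

theorem pi1_F_graph:
  assumes "base G \<in> verts G"
  shows "pi1 F = \<phi> ` pi1 G"
proof (intro equalityI subsetI)
  fix w assume "w \<in> pi1 F"
  then obtain p where p: "is_path F (Old (base G)) p (Old (base G))" "w = reduce (map (lab F) p)"
    by (auto simp: pi1_def path_label_def F_simps)
  have "lifts (base G) (Old (base G)) []"
    using assms phi_Nil by (auto simp: path_label_def intro!: exI[of _ "[]"])
  from lifts_path[OF p(1) this] show "w \<in> \<phi> ` pi1 G" using p(2) by (auto simp: pi1_def)
next
  fix w assume "w \<in> \<phi> ` pi1 G"
  then obtain p where p: "is_path G (base G) p (base G)" "w = \<phi> (path_label G p)"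
    by (auto simp: pi1_def)
  obtain q where "is_path F (base F) q (base F)" "\<phi> (path_label G p) = path_label F q"
    using reads_F_path[OF p(1)] by (auto simp: reads_def path_label_def F_simps)
  then show "w \<in> pi1 F" using p(2) unfolding pi1_def by blast
qed

end

section \<open>The core graph of a cyclic subgroup\<close>

lemma cyc_reduced_power:
  assumes "cyc_reduced c" "k \<ge> 1"
  shows "reduced (concat (replicate k c)) \<and> hd (concat (replicate k c)) = hd c \<and>
    last (concat (replicate k c)) = last c \<and> concat (replicate k c) \<noteq> []"
  using assms(2)
proof (induction k rule: nat_induct_at_least)
  case (Suc k)
  have "c \<noteq> []" using assms(1) by (simp add: cyc_reduced_def)
  then show ?case using Suc assms(1) by (auto simp: cyc_reduced_def reduced_append_iff)
qed (use assms in \<open>auto simp: cyc_reduced_def\<close>)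

lemma reduced_conj_power:
  assumes "cyc_reduced c" "reduced (p @ c @ inv_word p)" "k \<ge> 1"
  shows "reduced (p @ concat (replicate k c) @ inv_word p)"
  using cyc_reduced_power[OF assms(1,3)] assms(1,2)
  by (auto simp: reduced_append_iff cyc_reduced_def)

text \<open>In a power of p c p^-1 the inner stems cancel, and cyclic reducedness makes p c^k p^-1
  reduced, so the elements are known letter by letter. Negative powers are described through their
  inverses.\<close>

lemma generate_conj:
  assumes v: "p @ c @ inv_word p \<in> carrier (free_group X)" and c: "cyc_reduced c"
    and w: "w \<in> generate (free_group X) {p @ c @ inv_word p}"
  obtains "w = []"
  | k where "k \<ge> 1" "w = p @ concat (replicate k c) @ inv_word p"
  | k where "k \<ge> 1" "inv_word w = p @ concat (replicate k c) @ inv_word p"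
proof -
  interpret group "free_group X" by (rule group_free_group)
  let ?v = "p @ c @ inv_word p"
  have snoc: "concat (replicate k c) @ c = c @ concat (replicate k c)" for k
    by (induction k) auto
  have pow: "?v [^]\<^bsub>free_group X\<^esub> (k :: nat) = reduce (p @ concat (replicate k c) @ inv_word p)" for k
  proof (induction k)
    case (Suc k)
    have "?v [^]\<^bsub>free_group X\<^esub> Suc k = reduce (reduce (p @ concat (replicate k c) @ inv_word p) @ ?v)"
      using Suc by simp
    also have "\<dots> = reduce ((p @ concat (replicate k c)) @ inv_word p @ p @ (c @ inv_word p))"
      by (simp add: reduce_reduce_left)
    also have "\<dots> = reduce (p @ concat (replicate (Suc k) c) @ inv_word p)"
      unfolding reduce_cancel_mid using arg_cong[OF snoc[of k], of "\<lambda>x. reduce (p @ x @ inv_word p)"]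
      by simp
    finally show ?case .
  qed simp
  obtain k :: int where k: "w = ?v [^]\<^bsub>free_group X\<^esub> k"
    using w generate_pow[OF v] by auto
  have pos: "?v [^]\<^bsub>free_group X\<^esub> n = p @ concat (replicate n c) @ inv_word p" if "n \<ge> 1" for n :: nat
    using pow[of n] reduced_conj_power[OF c _ that] v by simp
  consider "k = 0" | "k > 0" | "k < 0" by linarith
  then show ?thesis
  proof cases
    case 1
    then show ?thesis using that(1) k by simp
  next
    case 2
    then have "?v [^]\<^bsub>free_group X\<^esub> k = ?v [^]\<^bsub>free_group X\<^esub> nat k"
      by (simp only: int_pow_def2) simp
    also have "\<dots> = p @ concat (replicate (nat k) c) @ inv_word p" using 2 by (intro pos) simp
    finally have "w = p @ concat (replicate (nat k) c) @ inv_word p" unfolding k .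
    moreover have "nat k \<ge> 1" using 2 by simp
    ultimately show ?thesis by (rule that(2)[rotated])
  next
    case 3
    let ?n = "nat (- k)"
    have n: "?n \<ge> 1" using 3 by simp
    have "?v [^]\<^bsub>free_group X\<^esub> k = inv\<^bsub>free_group X\<^esub> (?v [^]\<^bsub>free_group X\<^esub> ?n)"
      using 3 by (simp only: int_pow_def2) simp
    also have "\<dots> = inv_word (?v [^]\<^bsub>free_group X\<^esub> ?n)"
      by (rule inv_free_group[OF nat_pow_closed[OF v]])
    finally have "inv_word w = p @ concat (replicate ?n c) @ inv_word p"
      unfolding k pos[OF n] by simp
    then show ?thesis by (rule that(3)[OF n])
  qed
qed

lemma reads_same_vertex:
  assumes "labeled_graph Y G" "reads G (base G) w z" "reads G (base G) w' z"
  shows "reduce (w @ inv_word w') \<in> pi1 G"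
proof -
  have "reads G (base G) (w @ inv_word w') (base G)"
    using reads_append[OF assms(2) reads_inv_word[OF assms(1,3)]] .
  then obtain p where "is_path G (base G) p (base G)" "reduce (w @ inv_word w') = path_label G p"
    by (auto simp: path_label_def reads_def)
  then show ?thesis unfolding pi1_def by blast
qed

text \<open>Consecutive labels can cancel only if the second edge has the label of the reverse of
  the first; foldedness then makes it that reverse.\<close>

lemma reduced_path_label:
  assumes "labeled_graph Y G" "folded G" "is_path G u p v" "reduced_path G p"
  shows "reduced (map (lab G) p)"
  using assms(3,4)
proof (induction p arbitrary: u)
  case (Cons e p)
  then have IH: "reduced (map (lab G) p)"
    by (cases p) (auto simp: reduced_path_def)
  show ?case
  proof (cases p)
    case (Cons f q)
    have e: "e \<in> edges G" "f \<in> edges G" "init G f = init G (bar G e)" "f \<noteq> bar G e"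
      using Cons.prems Cons by (auto simp: reduced_path_def)
    then have "lab G f \<noteq> lab G (bar G e)"
      using assms(1,2) is_graphD(2)[OF labeled_graphD(1)[OF assms(1)]] unfolding folded_def by metis
    then show ?thesis using IH Cons e labeled_graphD(3)[OF assms(1)] by simp
  qed simp
qed simp

lemma core_stem_cycle:
  assumes core: "core_graph X S" and "p @ c @ inv_word p \<in> pi1 S"
  obtains stem cycle root where "is_path S (base S) stem root" "map (lab S) stem = p"
    "is_path S root cycle root" "map (lab S) cycle = c"
proof -
  have S: "labeled_graph X S" "is_graph S" "folded S"
    using core by (auto simp: core_graph_def labeled_graph_def)
  have "reads S (base S) (p @ c @ inv_word p) (base S)" using reads_pi1[OF S(1,3)] assms(2) by blast
  then obtain z where z: "reads S (base S) p z" "reads S z (c @ inv_word p) (base S)"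
    by (rule reads_appendE[OF S(2)])
  obtain z' where z': "reads S z c z'" "reads S z' (inv_word p) (base S)"
    using reads_appendE[OF S(2) z(2)] .
  \<comment> \<open>The vertices before and after \<open>c\<close> are both reached from the base
    point by \<open>p\<close>.\<close>
  have "z = z'" using reads_unique[OF S(3) z(1)] reads_inv_word[OF S(1) z'(2)] by simp
  then show ?thesis using that z(1) z'(1) unfolding reads_def by blast
qed

section \<open>The stem and the cycle of the core graph\<close>

locale lollipop =
  fixes X :: "'x set" and S :: "('v, 'e, 'x) pgraph" and p c :: "'x letter list"
    and stem cycle :: "'e list" and root :: 'v
  assumes core: "core_graph X S"
    and carrier: "p @ c @ inv_word p \<in> carrier (free_group X)"
    and pi1: "pi1 S = generate (free_group X) {p @ c @ inv_word p}"
    and cyc: "cyc_reduced c"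
    and stem_path: "is_path S (base S) stem root" "map (lab S) stem = p"
    and cycle_path: "is_path S root cycle root" "map (lab S) cycle = c"
begin

abbreviation "m \<equiv> length p"
abbreviation "N \<equiv> length p + length c"

lemma S: "labeled_graph X S" "is_graph S" "folded S" "connected_graph S" "base S \<in> verts S"
  using core by (auto simp: core_graph_def labeled_graph_def)

lemma c_nonempty: "c \<noteq> []" using cyc by (simp add: cyc_reduced_def)

lemma reduced_word: "reduced (p @ c @ inv_word p)" "reduced (p @ c)"
  using carrier reduced_append1[of "p @ c" "inv_word p"] by auto

text \<open>The walk along the stem and once around the cycle; it indexes the edges of the lollipop,
  up to reversal, by positions in \<open>p @ c\<close>.\<close>

definition D where "D = stem @ cycle"

lemma D_path: "is_path S (base S) D root" "map (lab S) D = p @ c" "length D = N" "set D \<subseteq> edges S"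
proof -
  show 1: "is_path S (base S) D root" unfolding D_def by (rule is_path_append[OF stem_path(1) cycle_path(1)])
  show 2: "map (lab S) D = p @ c" using stem_path cycle_path by (simp add: D_def)
  show "length D = N" using arg_cong[OF 2, of length] by simp
  show "set D \<subseteq> edges S" by (rule is_path_edges[OF 1])
qed

lemma length_stem: "length stem = m" and length_cycle: "length cycle = length c"
  using arg_cong[OF stem_path(2), of length] arg_cong[OF cycle_path(2), of length] by simp_all

lemma cycle_power: "is_path S root (concat (replicate k cycle)) root"
proof (induction k)
  case 0
  then show ?case using is_path_verts[OF S(2) cycle_path(1)] by simp
next
  case (Suc k)
  then show ?case using is_path_append[OF cycle_path(1)] by simp
qed

text \<open>Every edge lies on a reduced loop at the base point. The label of that loop is a power
  of p c p^-1, and by foldedness the loop itself must run along the stem, around the cycle and back,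
  or the reverse.\<close>

lemma edges_S: "edges S = set D \<union> bar S ` set D"
proof (intro equalityI subsetI)
  fix e assume "e \<in> edges S"
  then obtain R where R: "is_path S (base S) R (base S)" "reduced_path S R" "e \<in> set R"
    using core by (auto simp: core_graph_def)
  let ?r = "map (lab S) R"
  have r: "reduced ?r" using reduced_path_label[OF S(1,3) R(1,2)] .
  then have "?r \<in> generate (free_group X) {p @ c @ inv_word p}"
    using R(1) reads_pi1[OF S(1,3), of ?r] pi1 by (auto simp: reads_def)
  have power: "Q = stem @ concat (replicate k cycle) @ rev (map (bar S) stem)"
    if "is_path S (base S) Q (base S)" "map (lab S) Q = p @ concat (replicate k c) @ inv_word p" for Q k
  proof (rule path_unique[OF S(3) that(1)])
    show "is_path S (base S) (stem @ concat (replicate k cycle) @ rev (map (bar S) stem)) (base S)"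
      by (intro is_path_append[OF stem_path(1)] is_path_append[OF cycle_power] is_path_bar
          S(2) stem_path(1))
    have "map (lab S) (concat (replicate k cycle)) = concat (replicate k c)"
      using cycle_path(2) by (simp add: map_concat)
    then show "map (lab S) Q = map (lab S) (stem @ concat (replicate k cycle) @ rev (map (bar S) stem))"
      using that(2) stem_path(2) map_lab_bar[OF S(1) is_path_edges[OF stem_path(1)]]
      by simp
  qed
  have bb: "bar S (bar S f) = f" if "f \<in> set stem \<union> set cycle" for f
    using that D_path(4) is_graphD(3)[OF S(2)] by (auto simp: D_def)
  from carrier cyc \<open>?r \<in> generate _ _\<close> show "e \<in> set D \<union> bar S ` set D"
  proof (cases rule: generate_conj)
    case 1
    then show ?thesis using R(3) by simp
  next
    case (2 k)
    from power[OF R(1) 2(2)] have "e \<in> set stem \<union> set cycle \<union> bar S ` set stem"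
      using R(3) by auto
    then show ?thesis by (auto simp: D_def)
  next
    case (3 k)
    have "map (lab S) (rev (map (bar S) R)) = p @ concat (replicate k c) @ inv_word p"
      using map_lab_bar[OF S(1) is_path_edges[OF R(1)]] 3(2) by simp
    note R' = power[OF is_path_bar[OF S(2) R(1)] this]
    have "bar S ` set R \<subseteq> set stem \<union> set cycle \<union> bar S ` set stem"
      using arg_cong[OF R', of set] by auto
    then have "bar S e \<in> set stem \<union> set cycle \<union> bar S ` set stem" using R(3) by blast
    moreover have "bar S (bar S e) = e" using is_graphD(3)[OF S(2) \<open>e \<in> edges S\<close>] .
    ultimately have "e \<in> bar S ` (set stem \<union> set cycle) \<union> set stem"
      using bb by (elim UnE imageE) (metis UnI1 UnI2 image_eqI)+
    then show ?thesis by (auto simp: D_def)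
  qed
next
  fix e assume "e \<in> set D \<union> bar S ` set D"
  then show "e \<in> edges S" using D_path(4) is_graphD(2)[OF S(2)] by auto
qed

text \<open>Vertices are listed as starting points of the edges of \<open>D\<close>, at the
  positions below \<open>N\<close>. The end of \<open>D\<close> gets no index of its own, being the
  root \<open>q m\<close>.\<close>

definition q where "q i = init S (D ! i)"

lemma q_reads: "i < N \<Longrightarrow> reads S (base S) (take i (p @ c)) (q i)"
  using is_path_nth[OF S(2) D_path(1)] D_path(2,3)
  unfolding reads_def q_def by (metis take_map)

lemma q_root: "q m = root"
proof -
  have "is_path S (base S) (take m D) (q m)"
    using is_path_nth[OF S(2) D_path(1)] D_path(3) c_nonempty unfolding q_def by simp
  then show ?thesis
    using is_path_end_unique[OF stem_path(1)] length_stem by (simp add: D_def)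
qed

lemma D_end:
  assumes "i < N"
  shows "init S (bar S (D ! i)) = (if Suc i = N then root else q (Suc i))"
proof -
  have e: "D ! i \<in> edges S" using assms D_path(3,4) by (metis nth_mem subsetD)
  then have "init S (bar S (D ! i)) \<in> verts S" using is_graphD[OF S(2)] by blast
  then have "is_path S (q i) [D ! i] (init S (bar S (D ! i)))" using e by (simp add: q_def)
  moreover have "is_path S (base S) (take i D) (q i)"
    using is_path_nth[OF S(2) D_path(1)] D_path(3) assms unfolding q_def by simp
  ultimately have *: "is_path S (base S) (take (Suc i) D) (init S (bar S (D ! i)))"
    using is_path_append assms D_path(3) by (metis take_Suc_conv_app_nth)
  show ?thesis
  proof (cases "Suc i = N")
    case True
    then show ?thesis using * D_path(1,3) is_path_end_unique by fastforce
  next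
    case False
    then have "is_path S (base S) (take (Suc i) D) (q (Suc i))"
      using is_path_nth[OF S(2) D_path(1), of "Suc i"] D_path(3) assms unfolding q_def by simp
    then show ?thesis using * False is_path_end_unique by metis
  qed
qed

lemma verts_S: "verts S = q ` {..<N}"
proof (intro equalityI subsetI)
  fix z assume z: "z \<in> verts S"
  have N: "N > 0" using c_nonempty by simp
  have base: "base S = q 0"
    using D_path(1,3) N unfolding q_def by (cases D) auto
  obtain r where r: "is_path S (base S) r z" using S(4,5) z by (auto simp: connected_graph_def)
  show "z \<in> q ` {..<N}"
  proof (cases r rule: rev_cases)
    case Nil
    then have "z = q 0" using r base by simp
    then show ?thesis using N by blast
  next
    case (snoc r' e)
    then have "e \<in> edges S" "z = init S (bar S e)"
      using r is_path_append_iff[OF S(2)] by auto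
    then have "bar S e \<in> set D \<or> (\<exists>f\<in>set D. bar S e = bar S f)"
      using edges_S is_graphD(2)[OF S(2)] by blast
    then have "\<exists>i<N. z = init S (D ! i) \<or> z = init S (bar S (D ! i))"
      using \<open>z = _\<close> D_path(3) by (metis in_set_conv_nth)
    then obtain i where i: "i < N" "z = q i \<or> z = init S (bar S (D ! i))"
      by (auto simp: q_def)
    have "m < N" using c_nonempty by simp
    have "z = q i \<or> z = q m \<or> (Suc i < N \<and> z = q (Suc i))"
      using i D_end[OF i(1)] q_root by (auto split: if_splits)
    then show ?thesis using \<open>m < N\<close> i(1) by blast
  qed
next
  fix z assume "z \<in> q ` {..<N}"
  then show "z \<in> verts S" using q_reads is_path_verts[OF S(2)] unfolding reads_def by blast
qed

text \<open>Equality would put the quotient of two prefixes into the group, a word of length at most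
  i + j < 2m + |c|, while nontrivial elements have length at least 2m + |c|. Two positions on the
  cycle escape this count; they are separated later through the target graph.\<close>

lemma q_stem_distinct:
  assumes "i < j" "j < N" "i < m"
  shows "q i \<noteq> q j"
proof
  assume "q i = q j"
  let ?g = "reduce (take i (p @ c) @ inv_word (take j (p @ c)))"
  have "?g \<in> generate (free_group X) {p @ c @ inv_word p}"
    using reads_same_vertex[OF S(1) q_reads[of i], of "take j (p @ c)"] q_reads[of j]
      assms \<open>q i = q j\<close> pi1 by simp
  have "length ?g \<le> i + j"
    using length_reduce[of "take i (p @ c) @ inv_word (take j (p @ c))"] assms by simp
  moreover have "2 * m + length c \<le> length (p @ concat (replicate k c) @ inv_word p)" if "k \<ge> 1" for k
    using that by (cases k) auto
  ultimately have short: "\<not> length ?g \<ge> 2 * m + length c" "\<And>k. k \<ge> 1 \<Longrightarrow>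
      length (p @ concat (replicate k c) @ inv_word p) \<ge> 2 * m + length c"
    using assms by (force, blast)
  from carrier cyc \<open>?g \<in> _\<close> show False
  proof (cases rule: generate_conj)
    case 1
    have "reduced (take j (p @ c))"
      using reduced_append1[of "take j (p @ c)" "drop j (p @ c)"] reduced_word(2)
      unfolding append_take_drop_id .
    then have "take j (p @ c) = reduce (reduce (take i (p @ c) @ inv_word (take j (p @ c))) @ take j (p @ c))"
      unfolding 1 by simp
    also have "\<dots> = reduce (take i (p @ c))"
      unfolding reduce_reduce_left append_assoc reduce_cancel_end ..
    also have "\<dots> = take i (p @ c)"
      using reduced_append1[of "take i (p @ c)" "drop i (p @ c)"] reduced_word(2)
      unfolding append_take_drop_id by simp
    finally have "length (take j (p @ c)) = length (take i (p @ c))" by simp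
    then show False using assms by simp
  next
    case (2 k)
    then show ?thesis using short by metis
  next
    case (3 k)
    then show ?thesis using short inv_word_simps(6) by metis
  qed
qed

text \<open>The state after \<open>k\<close> trimming steps, described in closed form as an induced
  subgraph: \<open>trimmed 0\<close> is the whole lollipop and \<open>trimmed m\<close> is its
  cycle.\<close>

definition trimmed :: "nat \<Rightarrow> ('v, 'e, 'x) lgraph" where
  "trimmed k = \<lparr>verts = q ` {k..<N},
     edges = {e \<in> edges S. init S e \<in> q ` {k..<N} \<and> init S (bar S e) \<in> q ` {k..<N}},
     init = init S, bar = bar S, lab = lab S\<rparr>"

lemma trimmed_simps:
  "verts (trimmed k) = q ` {k..<N}"
  "e \<in> edges (trimmed k) \<longleftrightarrow> e \<in> edges S \<and> init S e \<in> q ` {k..<N} \<and> init S (bar S e) \<in> q ` {k..<N}"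
  "init (trimmed k) = init S" "bar (trimmed k) = bar S" "lab (trimmed k) = lab S"
  by (simp_all add: trimmed_def)

lemma trimmed_0: "trimmed 0 = lgraph.truncate S"
proof -
  have "init S e \<in> q ` {0..<N} \<and> init S (bar S e) \<in> q ` {0..<N}" if "e \<in> edges S" for e
    using that is_graphD[OF S(2) that] is_graphD(1)[OF S(2), of "bar S e"] verts_S
    by (simp add: atLeast0LessThan)
  then show ?thesis
    using verts_S by (auto simp: trimmed_def lgraph.truncate_def atLeast0LessThan)
qed

section \<open>Trimming the stem when the indexed vertices are distinct\<close>

context
  assumes inj_q: "inj_on q {..<N}"
begin

lemma q_eq: "i < N \<Longrightarrow> j < N \<Longrightarrow> q i = q j \<longleftrightarrow> i = j"
  using inj_q by (auto simp: inj_on_def)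

lemma q_mem: "i < N \<Longrightarrow> q i \<in> q ` {k..<N} \<longleftrightarrow> k \<le> i"
  using q_eq by auto

lemma D_edge: "i < N \<Longrightarrow> D ! i \<in> edges S"
  using D_path(3,4) by (metis nth_mem subsetD)

lemma D_end': "i < N \<Longrightarrow> init S (bar S (D ! i)) = q (if Suc i = N then m else Suc i)"
  using D_end q_root by simp

lemma D_trimmed:
  assumes "k \<le> m" "k \<le> i" "i < N"
  shows "D ! i \<in> edges (trimmed k)" "bar S (D ! i) \<in> edges (trimmed k)"
proof -
  have "m < N" using c_nonempty by simp
  then have "init S (D ! i) \<in> q ` {k..<N}" "init S (bar S (D ! i)) \<in> q ` {k..<N}"
    using assms q_mem D_end'[OF assms(3)] by (auto simp: q_def[symmetric])
  then show "D ! i \<in> edges (trimmed k)" "bar S (D ! i) \<in> edges (trimmed k)"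
    using D_edge[OF assms(3)] is_graphD[OF S(2) D_edge[OF assms(3)]] by (auto simp: trimmed_simps)
qed

text \<open>Away from the free end of the stem, each vertex has two outgoing edges: the next edge of
  \<open>D\<close> and the reverse of the preceding one. Their labels differ by reducedness of
  \<open>p @ c\<close>, and at the root of the bare cycle by cyclic reducedness of
  \<open>c\<close>.\<close>

lemma degree_trimmed:
  assumes "k \<le> m" "k \<le> i" "i < N" "degree (trimmed k) (q i) = 1"
  shows "i = k" "k < m"
proof -
  have False if "\<not> (i = k \<and> k < m)"
  proof -
    \<comment> \<open>The preceding position; when \<open>i = k = m\<close> it wraps around to the
      last edge of the cycle.\<close>
    define j where "j = (if i = k then N - 1 else i - 1)"
    have mN: "m < N" "m \<le> N - 1" using c_nonempty by (cases c; simp)+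
    have j: "k \<le> j" "j < N" "q i = init S (bar S (D ! j))"
      using that assms mN D_end'[of j] by (auto simp: j_def)
    have "lab S (D ! i) = (p @ c) ! i" "lab S (D ! j) = (p @ c) ! j"
      using assms(3) j(2) D_path(2,3) by (metis nth_map)+
    moreover have "(p @ c) ! i \<noteq> inv_letter ((p @ c) ! j)"
    proof (cases "i = k")
      case True
      then have "i = m" using that assms by auto
      then have "(p @ c) ! i = hd c" "(p @ c) ! j = last c"
        using True c_nonempty mN(2) by (auto simp: j_def nth_append hd_conv_nth last_conv_nth)
      then show ?thesis using cyc by (simp add: cyc_reduced_def)
    next
      case False
      then have "i = Suc j" using assms by (auto simp: j_def)
      then show ?thesis
        using reduced_word(2) assms(3) unfolding reduced_def by (auto simp: successively_conv_nth)
    qed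
    ultimately have "D ! i \<noteq> bar S (D ! j)"
      using labeled_graphD(3)[OF S(1) D_edge[OF j(2)]] by auto
    moreover have "D ! i \<in> {e \<in> edges (trimmed k). init S e = q i}"
      "bar S (D ! j) \<in> {e \<in> edges (trimmed k). init S e = q i}"
      using D_trimmed(1)[OF assms(1-3)] D_trimmed(2)[OF assms(1) j(1,2)] j(3) by (auto simp: q_def)
    moreover obtain x where "{e \<in> edges (trimmed k). init S e = q i} = {x}"
      using assms(4) unfolding degree_def trimmed_simps(3) by (rule card_1_singletonE)
    ultimately show False by (metis singletonD)
  qed
  then show "i = k" "k < m" by auto
qed

lemma out_trimmed:
  assumes "k < m"
  shows "{e \<in> edges (trimmed k). init (trimmed k) e = q k} = {D ! k}"
proof (intro equalityI subsetI)
  fix e assume "e \<in> {e \<in> edges (trimmed k). init (trimmed k) e = q k}"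
  then have e: "e \<in> edges S" "init S (bar S e) \<in> q ` {k..<N}" "init S e = q k"
    by (auto simp: trimmed_simps)
  then have "e \<in> set D \<or> e \<in> bar S ` set D" using edges_S by blast
  then consider i where "i < N" "e = D ! i" | i where "i < N" "e = bar S (D ! i)"
    using D_path(3) by (auto simp: in_set_conv_nth)
  then show "e \<in> {D ! k}"
  proof cases
    case 1
    then show ?thesis using e(3) q_eq[of i k] assms by (auto simp: q_def)
  next
    case 2
    \<comment> \<open>A reversed edge leaving \<open>q k\<close> would come from position k - 1,
      which is already trimmed, or from the closing edge of the cycle, which ends at
      \<open>q m\<close>.\<close>
    have "k \<le> i" using e(2) 2 q_mem is_graphD(3)[OF S(2) D_edge[OF 2(1)]] by (simp add: q_def)
    moreover have "q (if Suc i = N then m else Suc i) = q k" using D_end'[OF 2(1)] e(3) 2(2) by simp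
    then have "(if Suc i = N then m else Suc i) = k"
      using q_eq[of "if Suc i = N then m else Suc i" k] 2(1) assms c_nonempty by (auto split: if_splits)
    ultimately show ?thesis using assms by (auto split: if_splits)
  qed
next
  fix e assume "e \<in> {D ! k}"
  then show "e \<in> {e \<in> edges (trimmed k). init (trimmed k) e = q k}"
    using D_trimmed(1)[of k k] assms by (auto simp: trimmed_simps(3) q_def)
qed

text \<open>The edge \<open>D ! k\<close> and its reverse are the only edges touching
  \<open>q k\<close>, so removing them with the vertex again leaves an induced subgraph.\<close>

lemma trimmed_Suc:
  assumes "k < m"
  shows "trimmed (Suc k) = trimmed k\<lparr>verts := verts (trimmed k) - {q k},
     edges := edges (trimmed k) - {D ! k, bar (trimmed k) (D ! k)}\<rparr>"
proof -
  have k: "k < N" using assms by simp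
  have V: "q ` {Suc k..<N} = q ` {k..<N} - {q k}"
    using q_eq k by (auto simp: Suc_le_eq nat_less_le)
  note bD = is_graphD[OF S(2) D_edge[OF k]]
  have "e \<in> edges (trimmed (Suc k)) \<longleftrightarrow> e \<in> edges (trimmed k) - {D ! k, bar S (D ! k)}" for e
  proof
    assume "e \<in> edges (trimmed (Suc k))"
    then have "e \<in> edges (trimmed k)" "init S e \<noteq> q k" "init S (bar S e) \<noteq> q k"
      by (auto simp: trimmed_simps V)
    then show "e \<in> edges (trimmed k) - {D ! k, bar S (D ! k)}"
      using bD by (auto simp: q_def)
  next
    assume e: "e \<in> edges (trimmed k) - {D ! k, bar S (D ! k)}"
    then have eS: "e \<in> edges S" by (simp add: trimmed_simps)
    have "bar S e \<in> edges (trimmed k)"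
      using e is_graphD[OF S(2) eS] by (auto simp: trimmed_simps)
    moreover have "bar S e \<noteq> D ! k" using e is_graphD(3)[OF S(2) eS] by auto
    ultimately have "init S (bar S e) \<noteq> q k" "init S e \<noteq> q k"
      using out_trimmed[OF assms] e unfolding trimmed_simps(3) by blast+
    then show "e \<in> edges (trimmed (Suc k))" using e by (auto simp: trimmed_simps V)
  qed
  then have "edges (trimmed (Suc k)) = edges (trimmed k) - {D ! k, bar S (D ! k)}" by blast
  then show ?thesis using V by (simp add: trimmed_def)
qed

lemma trim_step_trimmed:
  assumes "k \<le> m"
  shows "trim_step (trimmed k) T \<longleftrightarrow> k < m \<and> T = trimmed (Suc k)"
proof
  assume "trim_step (trimmed k) T"
  then obtain v e where v: "v \<in> verts (trimmed k)" and e: "e \<in> edges (trimmed k)"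
    "degree (trimmed k) v = 1" "init (trimmed k) e = v"
    "T = trimmed k\<lparr>verts := verts (trimmed k) - {v},
       edges := edges (trimmed k) - {e, bar (trimmed k) e}\<rparr>"
    unfolding trim_step_def by blast
  then obtain i where i: "k \<le> i" "i < N" "v = q i" by (auto simp: trimmed_simps)
  with degree_trimmed[OF assms i(1,2)] e(2) have k: "i = k" "k < m" by auto
  then have "e = D ! k" using out_trimmed[OF k(2)] e(1,3) i(3) by blast
  then show "k < m \<and> T = trimmed (Suc k)" using trimmed_Suc[OF k(2)] e(4) i(3) k by simp
next
  assume k: "k < m \<and> T = trimmed (Suc k)"
  have "q k \<in> verts (trimmed k)" using k by (simp add: trimmed_simps)
  moreover have "D ! k \<in> edges (trimmed k)" "init (trimmed k) (D ! k) = q k"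
    using out_trimmed[of k] k by auto
  moreover have "degree (trimmed k) (q k) = 1" unfolding degree_def using out_trimmed[of k] k by simp
  ultimately show "trim_step (trimmed k) T"
    unfolding trim_step_def using trimmed_Suc[of k] k by blast
qed

text \<open>Trimming is deterministic here: the reachable graphs are the \<open>trimmed k\<close>
  with \<open>k <= m\<close>, and only the last admits no further step. Hence the choice in
  \<open>Trimf\<close> has a single candidate.\<close>

lemma Trimf_eq: "Trimf S = trimmed m"
proof -
  have "trim_step\<^sup>*\<^sup>* (trimmed 0) (trimmed k)" if "k \<le> m" for k
    using that
  proof (induction k)
    case (Suc k)
    then show ?case
      using trim_step_trimmed[of k "trimmed (Suc k)"] by (auto intro: rtranclp.rtrancl_into_rtrancl)
  qed simp
  moreover have "\<exists>k\<le>m. T = trimmed k" if "trim_step\<^sup>*\<^sup>* (trimmed 0) T" for T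
    using that by (induction rule: rtranclp_induct) (use trim_step_trimmed Suc_leI in blast)+
  ultimately show ?thesis
    unfolding Trimf_def trimmed_0[symmetric]
    using trim_step_trimmed by (intro some_equality) (blast, metis le_neq_implies_less)
qed

end

end

section \<open>Injectivity on the trimmed graph\<close>

lemma pointed_morphismD:
  assumes "pointed_morphism h"
  shows "vmap h (base (source h)) = base (target h)"
    "v \<in> verts (source h) \<Longrightarrow> vmap h v \<in> verts (target h)"
    "e \<in> edges (source h) \<Longrightarrow> emap h e \<in> edges (target h)"
    "e \<in> edges (source h) \<Longrightarrow> init (target h) (emap h e) = vmap h (init (source h) e)"
    "e \<in> edges (source h) \<Longrightarrow> bar (target h) (emap h e) = emap h (bar (source h) e)"
    "e \<in> edges (source h) \<Longrightarrow> lab (target h) (emap h e) = lab (source h) e"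
  using assms by (auto simp: pointed_morphism_def)

lemma pointed_morphism_reads:
  assumes "pointed_morphism h" "is_graph (source h)" "reads (source h) (base (source h)) w z"
  shows "reads (target h) (base (target h)) w (vmap h z)"
proof -
  have path: "is_path (target h) (vmap h u) (map (emap h) p) (vmap h z)"
    if "is_path (source h) u p z" for u p
    using that
  proof (induction p arbitrary: u)
    case Nil
    then show ?case using pointed_morphismD(2)[OF assms(1)] by auto
  next
    case (Cons e p)
    then have e: "e \<in> edges (source h)" "init (source h) e = u" by auto
    have "bar (source h) e \<in> edges (source h)" using is_graphD(2)[OF assms(2) e(1)] .
    then show ?case
      using Cons e by (simp add: pointed_morphismD[OF assms(1)])
  qed
  obtain p where p: "is_path (source h) (base (source h)) p z" "map (lab (source h)) p = w"
    using assms(3) by (auto simp: reads_def)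
  have "map (lab (target h)) (map (emap h) p) = w"
    using p(2) is_path_edges[OF p(1)] by (auto simp: subset_iff pointed_morphismD(6)[OF assms(1)])
  then show ?thesis
    using path[OF p(1)] unfolding reads_def pointed_morphismD(1)[OF assms(1)] by blast
qed

text \<open>Conjugation by \<open>p\<close> moves the base point to the root of the cycle, where the
  generators become c and w c w^-1, with w the reduced form of p^-1 u p. Both are loops at
  \<open>z\<close>, and loops are closed under products and inverses.\<close>

lemma conjugates_read:
  assumes G: "labeled_graph Y G" "folded G"
    and v: "p @ c @ inv_word p \<in> carrier (free_group X)" and u: "u \<in> carrier (free_group X)"
    and c: "reads G z c z" and w: "reads G z (reduce (inv_word p @ u @ p)) z'" "reads G z' c z'"
    and g: "g \<in> generate (free_group X) {p @ c @ inv_word p,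
      u \<otimes>\<^bsub>free_group X\<^esub> (p @ c @ inv_word p) \<otimes>\<^bsub>free_group X\<^esub> inv\<^bsub>free_group X\<^esub> u}"
  shows "reads G z (reduce (inv_word p @ g @ p)) z"
  using g
proof (induction rule: generate.induct)
  interpret group "free_group X" by (rule group_free_group)
  let ?v = "p @ c @ inv_word p"
  let ?c = "\<lambda>g. inv_word p @ g @ p"
  let ?w = "reduce (?c u)"
  let ?K = "{?v, u \<otimes>\<^bsub>free_group X\<^esub> ?v \<otimes>\<^bsub>free_group X\<^esub> inv\<^bsub>free_group X\<^esub> u}"
  have K: "?K \<subseteq> carrier (free_group X)" using v u by blast
  have Rv: "reduce (?c ?v) = reduce c"
    using reduce_cancel_mid(1)[of "[]" p "c @ inv_word p @ p"] reduce_cancel_end(1)[of c p] by simp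
  have v': "reads G z (reduce (?c ?v)) z" unfolding Rv by (rule reads_reduce[OF G c])
  have uvu: "reads G z (reduce (?c (reduce (reduce (u @ ?v) @ inv_word u)))) z"
  proof -
    have "reads G z (?w @ c @ inv_word ?w) z"
      by (intro reads_append[OF w(1)] reads_append[OF w(2)] reads_inv_word[OF G(1) w(1)])
    then have "reads G z (reduce (?w @ c @ inv_word ?w)) z" by (rule reads_reduce[OF G])
    also have "reduce (?w @ c @ inv_word ?w) = reduce (?c u @ c @ inv_word (?c u))"
      unfolding reduce_inv_word_commute[symmetric] reduce_reduce_left
      using reduce_reduce_right[of "?c u @ c" "inv_word (?c u)"] by simp
    also have "\<dots> = reduce (?c (u @ ?v @ inv_word u))" by simp
    also have "\<dots> = reduce (?c (reduce (reduce (u @ ?v) @ inv_word u)))"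
      by (simp only: reduce_inner reduce_reduce_left append_assoc)
    finally show ?thesis .
  qed
  {
    case one
    show ?case using reads_reduce[OF G reads_append[OF c reads_inv_word[OF G(1) c]]]
      by (simp add: reduce_inv_word)
  next
    case (incl h)
    then show ?case using v' uvu inv_free_group[OF u] by auto
  next
    case (inv h)
    have h: "h \<in> carrier (free_group X)" using inv K by blast
    have "reads G z (reduce (?c h)) z" using inv v' uvu inv_free_group[OF u] by auto
    from reads_inv_word[OF G(1) this]
    have "reads G z (reduce (?c (inv_word h))) z"
      by (simp add: reduce_inv_word_commute[symmetric])
    then show ?case using inv_free_group[OF h] by simp
  next
    case (eng h k)
    have "reads G z (reduce (reduce (?c h) @ reduce (?c k))) z"
      using reads_reduce[OF G reads_append[OF eng(3,4)]] .
    also have "reduce (reduce (?c h) @ reduce (?c k)) = reduce ((inv_word p @ h) @ p @ inv_word p @ (k @ p))"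
      by (simp add: reduce_reduce_left reduce_reduce_right)
    also have "\<dots> = reduce (?c (h \<otimes>\<^bsub>free_group X\<^esub> k))"
      unfolding reduce_cancel_mid by (simp add: reduce_inner)
    finally show ?case .
  }
qed

text \<open>The separating graph serves twice: it makes the vertex map injective on the cycle, and
  thereby shows that the indexed vertices of the source are distinct, on which the computation of
  \<open>Trimf\<close> rests. Injectivity on edges follows from that on vertices by foldedness of
  the source.\<close>

theorem injective_Trimf_morphism:
  fixes h :: "('v, 'e, 'w, 'f, 'x) parrow"
  assumes u: "u \<in> carrier (free_group X)"
    and v: "v \<in> carrier (free_group X)" "v \<noteq> []"
    and source: "is_Gamma X (generate (free_group X) {v}) (source h)"
    and target: "is_Gamma X (generate (free_group X)
      {v, u \<otimes>\<^bsub>free_group X\<^esub> v \<otimes>\<^bsub>free_group X\<^esub> inv\<^bsub>free_group X\<^esub> u}) (target h)"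
    and h: "pointed_morphism h"
  shows "injective_morphism (Trimf_morphism h)"
proof -
  let ?S = "source h" and ?T = "target h"
  obtain p c where pc: "v = p @ c @ inv_word p" "cyc_reduced c"
    using cyclic_reduction[of v] v by auto
  have core: "core_graph X ?S" and pi1: "pi1 ?S = generate (free_group X) {p @ c @ inv_word p}"
    using source pc(1) by (auto simp: is_Gamma_def)
  have "p @ c @ inv_word p \<in> pi1 ?S" unfolding pi1 by (simp add: generate.incl)
  then obtain stem cycle root where sc: "is_path ?S (base ?S) stem root" "map (lab ?S) stem = p"
    "is_path ?S root cycle root" "map (lab ?S) cycle = c"
    by (rule core_stem_cycle[OF core])
  interpret lollipop X ?S p c stem cycle root
    using core pi1 v pc sc by unfold_locales auto
  have T: "labeled_graph X ?T" "folded ?T"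
    using target by (auto simp: is_Gamma_def core_graph_def)
  \<comment> \<open>Seen from the root, the second generator is the conjugate of \<open>c\<close>
    itself by this word, so the two cycles have the same length.\<close>
  have "cycle_embeds c (reduce (inv_word p @ u @ p)) c" using pc(2) by (intro cycle_embeds) auto
  then obtain A E P z z' where E: "folded_on A E" "arc E z c P z"
    "reads (triple_graph E) z (reduce (inv_word p @ u @ p)) z'" "reads (triple_graph E) z' c z'"
    unfolding cycle_embeds_def by blast
  note tg = folded_on_triple_graph[OF E(1)]
  have P: "is_path (triple_graph E) z P z" "map (fst \<circ> snd) P = c" "distinct (map fst P)"
    using E(2) by (auto simp: arc_def)
  have lenP: "length P = length c" using arg_cong[OF P(2), of length] by simp
  have P_reads: "reads (triple_graph E) z (take i c) (fst (P ! i))" if "i < length c" for i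
    using is_path_nth[OF tg(3) P(1), of i] that lenP P(2) unfolding reads_def
    by (intro exI[of _ "take i P"]) (auto simp flip: take_map)
  have vmap_q: "i = j" if ij: "i < length c" "j < length c" "vmap h (q (m + i)) = vmap h (q (m + j))" for i j
  proof -
    have r: "reads ?T (base ?T) (p @ take i c) (vmap h (q (m + i)))" if "i < length c" for i
      using pointed_morphism_reads[OF h S(2) q_reads[of "m + i"]] that by simp
    \<comment> \<open>Two cycle positions with the same image give a loop of the target, hence an
      element of the group generated by v and u v u^-1.\<close>
    have "reduce ((p @ take i c) @ inv_word (p @ take j c)) \<in> pi1 ?T"
      using reads_same_vertex[OF T(1) r[OF ij(1), unfolded ij(3)] r[OF ij(2)]] .
    then have "reads (triple_graph E) z (reduce (inv_word p @
        reduce ((p @ take i c) @ inv_word (p @ take j c)) @ p)) z"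
      using target pc(1) v(1) by (intro conjugates_read[OF tg(1,2) _ u arc_reads[OF E(2)] E(3,4)])
        (auto simp: is_Gamma_def)
    also have "reduce (inv_word p @ reduce ((p @ take i c) @ inv_word (p @ take j c)) @ p)
        = reduce (inv_word p @ p @ (take i c @ inv_word (take j c)) @ inv_word p @ p)"
      unfolding reduce_inner by simp
    also have "\<dots> = reduce ((take i c @ inv_word (take j c)) @ inv_word p @ p)"
      using reduce_cancel_mid(1)[of "[]" p] by simp
    also have "\<dots> = reduce (take i c @ inv_word (take j c))"
      unfolding reduce_cancel_end ..
    finally have *: "reads (triple_graph E) z (reduce (take i c @ inv_word (take j c))) z" .
    have "reduced (take i c)"
      using reduced_append1[of "take i c" "drop i c"] pc(2) by (simp add: cyc_reduced_def)
    then have "fst (P ! i) = fst (P ! j)"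
      by (rule reads_same_end[OF tg(1,2) * P_reads[OF ij(1)] P_reads[OF ij(2)]])
    then show "i = j" using P(3) ij(1,2) lenP by (auto simp: distinct_map inj_on_def distinct_conv_nth)
  qed
  have q_neq: "q i \<noteq> q j" if "i < j" "j < N" for i j
  proof (cases "i < m")
    case True
    then show ?thesis using q_stem_distinct that by blast
  next
    case False
    then have "q i = q j \<Longrightarrow> i - m = j - m" using vmap_q[of "i - m" "j - m"] that by auto
    then show ?thesis using False that by linarith
  qed
  have inj_q: "inj_on q {..<N}"
    using q_neq by (auto simp: inj_on_def) (metis linorder_neqE_nat)
  note Trimf = Trimf_eq[OF inj_q]
  have V: "inj_on (vmap h) (verts (Trimf ?S))"
  proof (rule inj_onI)
    fix x y assume xy: "x \<in> verts (Trimf ?S)" "y \<in> verts (Trimf ?S)" "vmap h x = vmap h y"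
    then obtain i j where ij: "m \<le> i" "i < N" "x = q i" "m \<le> j" "j < N" "y = q j"
      by (auto simp: Trimf trimmed_simps)
    then have "i - m = j - m" using vmap_q[of "i - m" "j - m"] xy(3) by auto
    then have "i = j" using ij(1,4) by linarith
    then show "x = y" using ij(3,6) by simp
  qed
  have "inj_on (emap h) (edges (Trimf ?S))"
  proof (rule inj_onI)
    fix e f assume ef: "e \<in> edges (Trimf ?S)" "f \<in> edges (Trimf ?S)" "emap h e = emap h f"
    then have e: "e \<in> edges ?S" "f \<in> edges ?S"
      "init ?S e \<in> verts (Trimf ?S)" "init ?S f \<in> verts (Trimf ?S)"
      by (auto simp: Trimf trimmed_simps)
    then have "vmap h (init ?S e) = vmap h (init ?S f)" "lab ?S e = lab ?S f"
      using pointed_morphismD(4,6)[OF h] ef(3) by metis+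
    then show "e = f" using V e S(3) unfolding folded_def inj_on_def by blast
  qed
  then show ?thesis
    using V by (simp add: injective_morphism_def Trimf_morphism_def inj_on_restrict_eq)
qed

theorem theorem24:
  fixes a b :: 'y and X :: "'x set"
    and \<Gamma> :: "('v, 'e, 'y) pgraph" and \<Delta> :: "('w, 'f, 'y) pgraph"
    and m :: "('v, 'e, 'w, 'f, 'y) parrow"
  defines "F \<equiv> free_group {a, b}"
  assumes "a \<noteq> b"
    and "is_Gamma {a, b} (generate F {gen b}) \<Gamma>"
    and "is_Gamma {a, b} (generate F {gen b, gen a \<otimes>\<^bsub>F\<^esub> gen b \<otimes>\<^bsub>F\<^esub> inv\<^bsub>F\<^esub> gen a}) \<Delta>"
    and "pointed_morphism m" and "source m = \<Gamma>" and "target m = \<Delta>"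
    and "countable X" and "infinite X"
  shows "\<forall>g \<in> {Trimf_morphism h | \<phi> (h :: ('v1, 'e1, 'w1, 'f1, 'x) parrow).
                 \<phi> \<in> FGR_Hom ({a, b}, {}) (X, W X) \<and> is_Core X (F_morphism \<phi> m) h}.
           injective_morphism g"
proof clarify
  fix \<phi> and h :: "('v1, 'e1, 'w1, 'f1, 'x) parrow"
  assume \<phi>: "\<phi> \<in> FGR_Hom ({a, b}, {}) (X, W X)" and core: "is_Core X (F_morphism \<phi> m) h"
  have hom: "\<phi> \<in> hom F (free_group X)" and nontriv: "\<And>y. y \<in> {a, b} \<Longrightarrow> \<phi> (gen y) \<noteq> []"
    using \<phi> by (auto simp: FGR_Hom_def F_def)
  have \<Gamma>: "labeled_graph {a, b} \<Gamma>" "base \<Gamma> \<in> verts \<Gamma>" "pi1 \<Gamma> = generate F {gen b}"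
    and \<Delta>: "labeled_graph {a, b} \<Delta>" "base \<Delta> \<in> verts \<Delta>"
      "pi1 \<Delta> = generate F {gen b, gen a \<otimes>\<^bsub>F\<^esub> gen b \<otimes>\<^bsub>F\<^esub> inv\<^bsub>F\<^esub> gen a}"
    using assms(3,4) by (auto simp: is_Gamma_def core_graph_def)
  interpret \<phi>: group_hom F "free_group X" \<phi>
    using hom unfolding F_def by (intro group_hom.intro group_hom_axioms.intro group_free_group)
  have gens: "gen a \<in> carrier F" "gen b \<in> carrier F" by (auto simp: F_def gen_def letters_def)
  interpret \<Gamma>: nondegenerate "{a, b}" X \<phi> \<Gamma>
    using hom nontriv \<Gamma>(1) unfolding F_def by unfold_locales auto
  interpret \<Delta>: nondegenerate "{a, b}" X \<phi> \<Delta>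
    using hom nontriv \<Delta>(1) unfolding F_def by unfold_locales auto
  let ?u = "\<phi> (gen a)" and ?v = "\<phi> (gen b)"
  \<comment> \<open>\<open>Core\<close> sees a subdivided graph through its fundamental group, the
    image under \<phi> of the original one; generators map to generators.\<close>
  have "pi1 (F_graph \<phi> \<Gamma>) = generate (free_group X) {?v}"
    using \<Gamma>.pi1_F_graph[OF \<Gamma>(2)] \<Gamma>(3) \<phi>.generate_img[of "{gen b}"] gens by simp
  then have source: "is_Gamma X (generate (free_group X) {?v}) (source h)"
    using core assms(6) by (simp add: is_Core_def F_morphism_def)
  have "pi1 (F_graph \<phi> \<Delta>) = generate (free_group X)
      {?v, ?u \<otimes>\<^bsub>free_group X\<^esub> ?v \<otimes>\<^bsub>free_group X\<^esub> inv\<^bsub>free_group X\<^esub> ?u}"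
    using \<Delta>.pi1_F_graph[OF \<Delta>(2)] \<Delta>(3) gens
      \<phi>.generate_img[of "{gen b, gen a \<otimes>\<^bsub>F\<^esub> gen b \<otimes>\<^bsub>F\<^esub> inv\<^bsub>F\<^esub> gen a}"]
    by (simp del: free_group_simps)
  then have target: "is_Gamma X (generate (free_group X)
      {?v, ?u \<otimes>\<^bsub>free_group X\<^esub> ?v \<otimes>\<^bsub>free_group X\<^esub> inv\<^bsub>free_group X\<^esub> ?u}) (target h)"
    using core assms(7) by (simp add: is_Core_def F_morphism_def del: free_group_simps)
  show "injective_morphism (Trimf_morphism h)"
    using injective_Trimf_morphism[OF \<phi>.hom_closed[OF gens(1)] \<phi>.hom_closed[OF gens(2)] _ source target]
      nontriv core by (simp add: is_Core_def)
qed

end
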